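(* If there is a multiple $\mathfrak{d}$-pathway, then there is a Gruff ultrafilter.
   Context: All ultrafilters are non-principal. $\mathbb{Q}$ has its usual topology. A subset of a topological space is crowded if it has no isolated points (in the subspace topology); a perfect subset is a closed, non-empty, crowded subset. An ultrafilter $\mathcal{U}$ on $\mathbb{Q}$ is a Gruff ultrafilter if it has a base of perfect sets, i.e. every element of $\mathcal{U}$ contains an element of $\mathcal{U}$ that is a perfect subset of $\mathbb{Q}$. For $f,g\in\omega^\omega$, $f\le^* g$ means $f(n)\le g(n)$ for all but finitely many $n$. For a regular cardinal $\kappa>\omega_1$, $\mathsf{H}(\kappa)$ is the collection of all sets whose transitive closure has size less than $\kappa$; a well order $\trianglelefteq$ of $\mathsf{H}(\kappa)$ is fixed, and $\mathsf{Sub}(\kappa)$ is the set of all countable $M\subseteq\mathsf{H}(\kappa)$ such that $(M,\in,\trianglelefteq)$ is an elementary submodel of $(\mathsf{H}(\kappa),\in,\trianglelefteq)$. The height of $M$ is $\delta_M=M\cap\omega_1$, a countable ordinal. A finite sequence $\langle M_0,\dots,M_n\rangle$ of such models is $\delta$-increasing if $\delta_{M_i}\le\delta_{M_{i+1}}$ for each $i<n$. A relation $R\subseteq X^{n}\times\omega^\omega$ is $\le^*$-adequate if for all $x_1,\dots,x_n\in X$ there is $f\in\omega^\omega$ such that for every increasing $g\in\omega^\omega$, if $g\not\le^* f$ then $R(x_1,\dots,x_n,g)$ holds. Let $\kappa>\mathfrak{c}$ be a regular cardinal, $\mathcal{B}=\{f_\alpha\mid\alpha<\omega_1\}\subseteq\omega^\omega$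 an indexed family of increasing functions, and $\mathcal{S}\subseteq\mathsf{Sub}(\kappa)$ a stationary subset of $[\mathsf{H}(\kappa)]^\omega$ such that $\mathcal{B}\in M$ for every $M\in\mathcal{S}$. The pair $(\mathcal{B},\mathcal{S})$ is a multiple $\mathfrak{d}$-pathway if for every $\delta$-increasing sequence $\langle M_0,\dots,M_n\rangle$ of models from $\mathcal{S}$, every projective $\le^*$-adequate relation $R\subseteq(\omega^\omega)^{n+2}$ with $R\in M_n$, and all $x_i\in M_i\cap\omega^\omega$ ($i\le n$), $R(x_0,\dots,x_n,f_{\delta_{M_n}})$ holds. *)

theory Defs
  imports "HOL-Analysis.Analysis"
begin

unbundle cardinal_syntax

section \<open>Gruff ultrafilters\<close>

definition ultrafilter_on :: "'a set \<Rightarrow> 'a set set \<Rightarrow> bool" where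
  "ultrafilter_on X U \<longleftrightarrow>
     U \<subseteq> Pow X \<and> X \<in> U \<and> {} \<notin> U \<and>
     (\<forall>A\<in>U. \<forall>B\<in>U. A \<inter> B \<in> U) \<and>
     (\<forall>A\<in>U. \<forall>B. A \<subseteq> B \<and> B \<subseteq> X \<longrightarrow> B \<in> U) \<and>
     (\<forall>A. A \<subseteq> X \<longrightarrow> A \<in> U \<or> X - A \<in> U)"

definition principal_on :: "'a set \<Rightarrow> 'a set set \<Rightarrow> bool" where
  "principal_on X U \<longleftrightarrow> (\<exists>x\<in>X. U = {A. A \<subseteq> X \<and> x \<in> A})"

definition crowded :: "'a::topological_space set \<Rightarrow> bool" where
  "crowded A \<longleftrightarrow> \<not> (\<exists>x. x isolated_in A)"

text \<open>The space of rationals is the subspace \<open>\<rat>\<close> of the reals.\<close>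

definition perfect_rat :: "real set \<Rightarrow> bool" where
  "perfect_rat P \<longleftrightarrow> closedin (top_of_set \<rat>) P \<and> P \<noteq> {} \<and> crowded P"

definition gruff_ultrafilter :: "real set set \<Rightarrow> bool" where
  "gruff_ultrafilter U \<longleftrightarrow>
     ultrafilter_on \<rat> U \<and> \<not> principal_on \<rat> U \<and>
     (\<forall>A\<in>U. \<exists>P\<in>U. P \<subseteq> A \<and> perfect_rat P)"

section \<open>The structure of sets with transitive closure of size less than \<open>\<kappa>\<close>\<close>

definition elts :: "'h rel \<Rightarrow> 'h \<Rightarrow> 'h set" where
  "elts E x = {y. (y, x) \<in> E}"

definition trcl_set :: "'h rel \<Rightarrow> 'h set \<Rightarrow> 'h set" where
  "trcl_set E A = {y. \<exists>x\<in>A. (y, x) \<in> E\<^sup>*}"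

text \<open>
  \<open>is_H \<kappa> E\<close> says that the type \<open>'h\<close>, with \<open>E\<close> as membership relation, is (an isomorphic copy
  of) \<open>H(\<kappa>)\<close>: \<open>E\<close> is well-founded and extensional, and the collections \<open>A\<close> of elements that
  are sets of the structure are exactly those whose transitive closure has size less than
  \<open>\<kappa>\<close>. By Mostowski collapse this determines the structure up to a unique isomorphism.
\<close>

definition is_H :: "'k rel \<Rightarrow> 'h rel \<Rightarrow> bool" where
  "is_H \<kappa> E \<longleftrightarrow>
     wf E \<and>
     (\<forall>x y. elts E x = elts E y \<longrightarrow> x = y) \<and>
     (\<forall>A. (\<exists>x. elts E x = A) \<longleftrightarrow> |trcl_set E A| <o \<kappa>)"

subsection \<open>Codes of concrete objects\<close>

text \<open>
  \<open>set_of E A\<close> is the element of the structure whose members are the elements of \<open>A\<close>. It is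
  only meaningful if \<open>A\<close> has a small transitive closure, as is the case for all sets below.
  Pairs are Kuratowski pairs, natural numbers are von Neumann numerals, functions and
  tuples are their graphs.
\<close>

definition set_of :: "'h rel \<Rightarrow> 'h set \<Rightarrow> 'h" where
  "set_of E A = (THE x. elts E x = A)"

definition pair_code :: "'h rel \<Rightarrow> 'h \<Rightarrow> 'h \<Rightarrow> 'h" where
  "pair_code E a b = set_of E {set_of E {a}, set_of E {a, b}}"

definition fun_code :: "'h rel \<Rightarrow> 'i set \<Rightarrow> ('i \<Rightarrow> 'h) \<Rightarrow> ('i \<Rightarrow> 'h) \<Rightarrow> 'h" where
  "fun_code E I dom_code val_code = set_of E ((\<lambda>i. pair_code E (dom_code i) (val_code i)) ` I)"

primrec nat_code :: "'h rel \<Rightarrow> nat \<Rightarrow> 'h" where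
  "nat_code E 0 = set_of E {}"
| "nat_code E (Suc n) = set_of E (insert (nat_code E n) (elts E (nat_code E n)))"

definition baire_code :: "'h rel \<Rightarrow> (nat \<Rightarrow> nat) \<Rightarrow> 'h" where
  "baire_code E f = fun_code E UNIV (nat_code E) (\<lambda>n. nat_code E (f n))"

definition tuple_code :: "'h rel \<Rightarrow> nat \<Rightarrow> (nat \<Rightarrow> nat \<Rightarrow> nat) \<Rightarrow> 'h" where
  "tuple_code E k x = fun_code E {..<k} (nat_code E) (\<lambda>i. baire_code E (x i))"

definition rel_code :: "'h rel \<Rightarrow> nat \<Rightarrow> (nat \<Rightarrow> nat \<Rightarrow> nat) set \<Rightarrow> 'h" where
  "rel_code E k R = set_of E (tuple_code E k ` R)"

definition is_ordinal :: "'h rel \<Rightarrow> 'h \<Rightarrow> bool" where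
  "is_ordinal E x \<longleftrightarrow>
     (\<forall>y\<in>elts E x. elts E y \<subseteq> elts E x) \<and>
     (\<forall>y\<in>elts E x. \<forall>z\<in>elts E x. (y, z) \<in> E \<or> y = z \<or> (z, y) \<in> E)"

definition omega1 :: "'h rel \<Rightarrow> 'h set" where
  "omega1 E = {\<alpha>. is_ordinal E \<alpha> \<and> countable (elts E \<alpha>)}"

text \<open>
  A family \<open>\<langle>f\<^sub>\<alpha> | \<alpha> < \<omega>\<^sub>1\<rangle>\<close> is indexed by the countable ordinals of the structure; the values
  of \<open>\<B>\<close> outside \<open>omega1 E\<close> are irrelevant.
\<close>

definition family_code :: "'h rel \<Rightarrow> ('h \<Rightarrow> nat \<Rightarrow> nat) \<Rightarrow> 'h" where
  "family_code E \<B> = fun_code E (omega1 E) (\<lambda>\<alpha>. \<alpha>) (\<lambda>\<alpha>. baire_code E (\<B> \<alpha>))"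

subsection \<open>Countable elementary submodels\<close>

datatype fm =
    FMem nat nat
  | FLeq nat nat
  | FEq nat nat
  | FNeg fm
  | FConj fm fm
  | FEx nat fm

primrec sat :: "'h rel \<Rightarrow> 'h rel \<Rightarrow> 'h set \<Rightarrow> (nat \<Rightarrow> 'h) \<Rightarrow> fm \<Rightarrow> bool" where
  "sat E W M v (FMem i j) \<longleftrightarrow> (v i, v j) \<in> E"
| "sat E W M v (FLeq i j) \<longleftrightarrow> (v i, v j) \<in> W"
| "sat E W M v (FEq i j) \<longleftrightarrow> v i = v j"
| "sat E W M v (FNeg \<phi>) \<longleftrightarrow> \<not> sat E W M v \<phi>"
| "sat E W M v (FConj \<phi> \<psi>) \<longleftrightarrow> sat E W M v \<phi> \<and> sat E W M v \<psi>"
| "sat E W M v (FEx i \<phi>) \<longleftrightarrow> (\<exists>a\<in>M. sat E W M (v(i := a)) \<phi>)"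

definition elementary :: "'h rel \<Rightarrow> 'h rel \<Rightarrow> 'h set \<Rightarrow> bool" where
  "elementary E W M \<longleftrightarrow>
     M \<noteq> {} \<and> (\<forall>\<phi> v. range v \<subseteq> M \<longrightarrow> (sat E W M v \<phi> \<longleftrightarrow> sat E W UNIV v \<phi>))"

definition Sub :: "'h rel \<Rightarrow> 'h rel \<Rightarrow> 'h set set" where
  "Sub E W = {M. countable M \<and> elementary E W M}"

definition height :: "'h rel \<Rightarrow> 'h set \<Rightarrow> 'h" where
  "height E M = set_of E (M \<inter> omega1 E)"

text \<open>The order on von Neumann ordinals is membership or equality.\<close>

definition delta_increasing :: "'h rel \<Rightarrow> nat \<Rightarrow> (nat \<Rightarrow> 'h set) \<Rightarrow> bool" where
  "delta_increasing E n M \<longleftrightarrow> (\<forall>i<n. (height E (M i), height E (M (Suc i))) \<in> E\<^sup>=)"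

subsection \<open>Stationary sets\<close>

definition ctbl_subsets :: "'h set \<Rightarrow> 'h set set" where
  "ctbl_subsets X = {A. A \<subseteq> X \<and> countable A \<and> infinite A}"

definition club_in :: "'h set \<Rightarrow> 'h set set \<Rightarrow> bool" where
  "club_in X C \<longleftrightarrow>
     C \<subseteq> ctbl_subsets X \<and>
     (\<forall>A\<in>ctbl_subsets X. \<exists>B\<in>C. A \<subseteq> B) \<and>
     (\<forall>Y :: nat \<Rightarrow> 'h set. incseq Y \<and> range Y \<subseteq> C \<longrightarrow> (\<Union>i. Y i) \<in> C)"

definition stationary_in :: "'h set \<Rightarrow> 'h set set \<Rightarrow> bool" where
  "stationary_in X S \<longleftrightarrow>
     S \<subseteq> ctbl_subsets X \<and> (\<forall>C. club_in X C \<longrightarrow> S \<inter> C \<noteq> {})"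

section \<open>Projective and adequate relations\<close>

text \<open>
  A \<open>k\<close>-ary relation on \<open>\<omega>\<^sup>\<omega>\<close> is a subset of the product \<open>{..<k} \<rightarrow>\<^sub>E UNIV\<close>. The type
  \<^typ>\<open>nat \<Rightarrow> nat\<close> carries the product topology of the discrete topology on \<^typ>\<open>nat\<close>.
\<close>

definition baire_power :: "nat \<Rightarrow> (nat \<Rightarrow> nat \<Rightarrow> nat) topology" where
  "baire_power k = product_topology (\<lambda>_. euclidean) {..<k}"

text \<open>
  The projective relations are those obtained from Borel relations by complements and
  projections along \<open>\<omega>\<^sup>\<omega>\<close> (boldface, i.e. real parameters are allowed).
\<close>

inductive projective :: "nat \<Rightarrow> (nat \<Rightarrow> nat \<Rightarrow> nat) set \<Rightarrow> bool" where
  borel: "A \<in> sigma_sets (topspace (baire_power k)) {U. openin (baire_power k) U}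
            \<Longrightarrow> projective k A"
| compl: "projective k A \<Longrightarrow> projective k (topspace (baire_power k) - A)"
| proj: "projective (Suc k) A \<Longrightarrow> projective k ((\<lambda>x. restrict x {..<k}) ` A)"

definition le_star :: "(nat \<Rightarrow> nat) \<Rightarrow> (nat \<Rightarrow> nat) \<Rightarrow> bool" (infix \<open>\<le>\<^sup>*\<close> 50) where
  "f \<le>\<^sup>* g \<longleftrightarrow> (\<forall>\<^sub>F n in sequentially. f n \<le> g n)"

text \<open>\<open>tuple_snoc m x g\<close> is the \<open>m + 1\<close>-tuple \<open>(x\<^sub>0, \<dots>, x\<^bsub>m-1\<^esub>, g)\<close>.\<close>

definition tuple_snoc :: "nat \<Rightarrow> (nat \<Rightarrow> 'a) \<Rightarrow> 'a \<Rightarrow> nat \<Rightarrow> 'a" where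
  "tuple_snoc m x g = restrict (x(m := g)) {..<Suc m}"

text \<open>Adequacy of a relation \<open>R \<subseteq> (\<omega>\<^sup>\<omega>)\<^sup>m \<times> \<omega>\<^sup>\<omega>\<close>. Increasing functions are strictly increasing.\<close>

definition adequate :: "nat \<Rightarrow> (nat \<Rightarrow> nat \<Rightarrow> nat) set \<Rightarrow> bool" where
  "adequate m R \<longleftrightarrow>
     (\<forall>x \<in> {..<m} \<rightarrow>\<^sub>E UNIV. \<exists>f. \<forall>g. strict_mono g \<and> \<not> g \<le>\<^sup>* f \<longrightarrow> tuple_snoc m x g \<in> R)"

section \<open>Multiple \<open>\<dd>\<close>-pathways\<close>

definition multiple_d_pathway ::
    "'h rel \<Rightarrow> 'h rel \<Rightarrow> ('h \<Rightarrow> nat \<Rightarrow> nat) \<Rightarrow> 'h set set \<Rightarrow> bool" where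
  "multiple_d_pathway E W \<B> \<S> \<longleftrightarrow>
     (\<forall>\<alpha>\<in>omega1 E. strict_mono (\<B> \<alpha>)) \<and>
     \<S> \<subseteq> Sub E W \<and>
     stationary_in UNIV \<S> \<and>
     (\<forall>M\<in>\<S>. family_code E \<B> \<in> M) \<and>
     (\<forall>n M R x.
        (\<forall>i\<le>n. M i \<in> \<S>) \<and> delta_increasing E n M \<and>
        projective (n + 2) R \<and> adequate (n + 1) R \<and> rel_code E (n + 2) R \<in> M n \<and>
        (\<forall>i\<le>n. baire_code E (x i) \<in> M i)
        \<longrightarrow> tuple_snoc (n + 1) x (\<B> (height E (M n))) \<in> R)"

end

theory Submission
  imports Defs
begin

text \<open>
  Embed \<open>\<rat>\<close> together with an extra point \<open>0\<close> (a point at infinity) into Cantor space. For a set \<open>X\<close>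
  and an increasing \<open>f\<close>, the set \<open>thin f X\<close> consists of the points reached from \<open>0\<close> by a tree in which
  the children of a node \<open>x\<close> at distance level \<open>m\<close> are the \<open>y \<in> X\<close> with index below \<open>f m\<close>, surrounded by
  disjoint balls. It is always closed, it is monotone in \<open>X\<close>, and if \<open>X\<close> is crowded and \<open>f\<close> is not
  eventually dominated by a function depending on \<open>X\<close>, then it is crowded. Hence the relation ``if
  some finite intersection of sets, part of them already thinned, contains a crowded set around \<open>0\<close>,
  then so does the intersection after thinning the remaining sets by \<open>g\<close>'' is adequate; it is also
  projective. By recursion on \<open>\<delta>\<close> choose an ultrafilter \<open>w \<delta>\<close> of sets that are non-scattered around \<open>0\<close>,
  containing all \<open>thin (\<B> \<gamma>) X\<close> with \<open>\<gamma> < \<delta>\<close> and \<open>X \<in> w \<gamma>\<close> in a model of height \<open>\<gamma>\<close>; the pathway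
  applied to these relations keeps the recursion going. Since every \<open>A \<subseteq> \<rat>\<close> lies in some model, the
  perfect kernels of all the thinned sets generate a Gruff ultrafilter.
\<close>

section \<open>Thinning sets of points of Cantor space\<close>

locale cantor_points =
  fixes \<sigma> :: "nat \<Rightarrow> nat \<Rightarrow> bool"
  assumes inj_\<sigma>: "inj \<sigma>"
begin

section \<open>Agreement, first differences and crowded sets\<close>

definition agree :: "nat \<Rightarrow> nat \<Rightarrow> nat \<Rightarrow> bool" where
  "agree n x y \<longleftrightarrow> (\<forall>j<n. \<sigma> x j = \<sigma> y j)"

definition dif :: "nat \<Rightarrow> nat \<Rightarrow> nat" where
  "dif x y = (LEAST j. \<sigma> x j \<noteq> \<sigma> y j)"

text \<open>Exceeds \<open>n\<close> and every \<open>dif i j\<close> with \<open>i, j < n\<close>,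
  so indices below \<open>n\<close> that agree up to \<open>sep n\<close> coincide. The meaningless
  diagonal terms \<open>dif i i\<close> only enlarge the bound.\<close>

definition sep :: "nat \<Rightarrow> nat" where
  "sep n = Suc n + (\<Sum>i<n. \<Sum>j<n. Suc (dif i j))"

definition crowd :: "nat set \<Rightarrow> bool" where
  "crowd C \<longleftrightarrow> (\<forall>x\<in>C. \<forall>n. \<exists>y\<in>C. y \<noteq> x \<and> agree n x y)"

definition rich :: "nat set \<Rightarrow> bool" where
  "rich X \<longleftrightarrow> (\<exists>C. crowd C \<and> 0 \<in> C \<and> C \<subseteq> insert 0 X)"

lemma agree_refl [simp]: "agree n x x"
  by (simp add: agree_def)

lemma agree_sym: "agree n x y \<Longrightarrow> agree n y x"
  by (simp add: agree_def)

lemma agree_trans: "agree n x y \<Longrightarrow> agree n y z \<Longrightarrow> agree n x z"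
  by (simp add: agree_def)

lemma agree_mono: "agree n x y \<Longrightarrow> m \<le> n \<Longrightarrow> agree m x y"
  by (simp add: agree_def)

lemma dif_differs:
  assumes "x \<noteq> y" shows "\<sigma> x (dif x y) \<noteq> \<sigma> y (dif x y)"
proof -
  have "\<sigma> x \<noteq> \<sigma> y" using assms inj_\<sigma> by (auto dest: injD)
  then obtain j where "\<sigma> x j \<noteq> \<sigma> y j" by auto
  then show ?thesis unfolding dif_def by (rule LeastI)
qed

lemma agree_iff_le_dif:
  assumes "x \<noteq> y" shows "agree n x y \<longleftrightarrow> n \<le> dif x y"
proof
  assume "agree n x y"
  with dif_differs[OF assms] show "n \<le> dif x y" by (metis agree_def not_le)
next
  assume n: "n \<le> dif x y"
  show "agree n x y" unfolding agree_def
  proof (intro allI impI)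
    fix j assume "j < n"
    with n have "j < (LEAST j. \<sigma> x j \<noteq> \<sigma> y j)" by (simp add: dif_def)
    from not_less_Least[OF this] show "\<sigma> x j = \<sigma> y j" by simp
  qed
qed

lemma dif_less_sep:
  assumes "i < n" "j < n" shows "dif i j < sep n"
proof -
  have "Suc (dif i j) \<le> (\<Sum>j<n. Suc (dif i j))"
    using assms by (intro member_le_sum) auto
  also have "\<dots> \<le> (\<Sum>i<n. \<Sum>j<n. Suc (dif i j))"
    using assms by (intro member_le_sum[of i _ "\<lambda>i. \<Sum>j<n. Suc (dif i j)"]) auto
  finally show ?thesis by (simp add: sep_def)
qed

lemma less_sep: "n < sep n"
  by (simp add: sep_def)

lemma sep_agree_imp_eq:
  assumes "i < n" "j < n" "agree (sep n) i j" shows "i = j"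
  using assms dif_less_sep[of i n j] agree_iff_le_dif[of i j "sep n"] by force

text \<open>
  \<open>desc f X n x k z\<close>: \<open>z\<close> is reached from \<open>x\<close> in at most \<open>n\<close> steps, where points agreeing with \<open>x\<close>
  below \<open>k\<close> are the ones available. By the choice of \<open>sep\<close>, the balls around the children chosen
  at one level are disjoint.
\<close>

primrec desc :: "(nat \<Rightarrow> nat) \<Rightarrow> nat set \<Rightarrow> nat \<Rightarrow> nat \<Rightarrow> nat \<Rightarrow> nat \<Rightarrow> bool" where
  "desc f X 0 x k z \<longleftrightarrow> z = x"
| "desc f X (Suc n) x k z \<longleftrightarrow> z = x \<or>
     (\<exists>y\<in>X. y \<noteq> x \<and> k \<le> dif x y \<and> y < f (dif x y) \<and>
        desc f X n y (sep (f (dif x y))) z)"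

definition reach :: "(nat \<Rightarrow> nat) \<Rightarrow> nat set \<Rightarrow> nat \<Rightarrow> nat \<Rightarrow> nat set" where
  "reach f X x k = {z. \<exists>n. desc f X n x k z}"

definition thin :: "(nat \<Rightarrow> nat) \<Rightarrow> nat set \<Rightarrow> nat set" where
  "thin f X = reach f X 0 0"

section \<open>Branches of the thinning tree\<close>

lemma reach_cases:
  assumes "z \<in> reach f X x k"
  obtains "z = x"
  | y where "y \<in> X" "y \<noteq> x" "k \<le> dif x y" "y < f (dif x y)"
      "z \<in> reach f X y (sep (f (dif x y)))"
  using assms unfolding reach_def by simp (metis desc.simps not0_implies_Suc)

lemma reach_root: "x \<in> reach f X x k"
  unfolding reach_def using desc.simps(1) by blast

lemma reach_step:
  assumes "y \<in> X" "y \<noteq> x" "k \<le> dif x y" "y < f (dif x y)"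
    "z \<in> reach f X y (sep (f (dif x y)))"
  shows "z \<in> reach f X x k"
  using assms unfolding reach_def by simp (metis desc.simps(2))

lemma desc_mono: "desc f X n x k z \<Longrightarrow> X \<subseteq> Y \<Longrightarrow> desc f Y n x k z"
  by (induction n arbitrary: x k) auto

lemma thin_mono: "X \<subseteq> Y \<Longrightarrow> thin f X \<subseteq> thin f Y"
  unfolding thin_def reach_def using desc_mono by blast

lemma desc_subset: "desc f X n x k z \<Longrightarrow> z \<in> insert x X"
  by (induction n arbitrary: x k) auto

lemma thin_subset: "thin f X \<subseteq> insert 0 X"
  unfolding thin_def reach_def using desc_subset by blast

lemma zero_in_thin: "0 \<in> thin f X"
  unfolding thin_def by (rule reach_root)

text \<open>Radii only grow along a branch:
  \<open>k \<le> dif x y \<le> f (dif x y) < sep (f (dif x y))\<close>, so later points never leave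
  the ball around \<open>x\<close>.\<close>

lemma desc_agree:
  assumes f: "strict_mono f" and "desc f X n x k z" shows "agree k x z"
  using assms(2)
proof (induction n arbitrary: x k)
  case (Suc n)
  show ?case
  proof (cases "z = x")
    case False
    with Suc.prems obtain y where y: "y \<noteq> x" "k \<le> dif x y"
      "desc f X n y (sep (f (dif x y))) z" by auto
    have "k \<le> sep (f (dif x y))"
      using y(2) less_sep[of "f (dif x y)"] strict_mono_imp_increasing[OF f, of "dif x y"] by linarith
    with Suc.IH[OF y(3)] have "agree k y z" by (rule agree_mono)
    moreover have "agree k x y" using y by (simp add: agree_iff_le_dif)
    ultimately show ?thesis by (rule agree_trans[rotated])
  qed simp
qed simp

lemma reach_agree: "strict_mono f \<Longrightarrow> z \<in> reach f X x k \<Longrightarrow> agree k x z"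
  unfolding reach_def using desc_agree by blast

section \<open>Thinned sets are closed\<close>

lemma dif_eqI:
  assumes "agree m x z" "\<sigma> x m \<noteq> \<sigma> z m" shows "dif x z = m"
  using assms unfolding dif_def agree_def by (intro Least_equality) (auto simp: not_less[symmetric])

text \<open>
  A point \<open>z\<close> can only lie in the ball around a child \<open>y \<noteq> z\<close> chosen below \<open>f m\<close> when \<open>f m \<le> z\<close>,
  while the radii \<open>k\<close> strictly increase along a branch; hence the measure \<open>Suc z - k\<close>.
\<close>

lemma reach_closed:
  assumes f: "strict_mono f"
  shows "agree k x z \<Longrightarrow> z \<notin> reach f X x k \<Longrightarrow> \<exists>n. \<forall>w\<in>reach f X x k. \<not> agree n z w"
proof (induction "Suc z - k" arbitrary: x k rule: less_induct)
  case less
  have zx: "z \<noteq> x" using less.prems(2) reach_root by auto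
  define m where "m = dif x z"
  define s where "s = sep (f m)"
  have km: "k \<le> m" using less.prems(1) zx by (simp add: m_def agree_iff_le_dif)
  have ms: "m < s" "m \<le> f m"
    using less_sep[of "f m"] strict_mono_imp_increasing[OF f, of m] by (auto simp: s_def)
  \<comment> \<open>A reachable point agreeing with \<open>z\<close> up to \<open>s\<close> leaves
    \<open>x\<close> at the same level \<open>m\<close> as \<open>z\<close> does, so its branch
    passes through a child at that level whose ball of radius \<open>s\<close> contains
    \<open>z\<close>.\<close>
  have child: "\<exists>y\<in>X. y \<noteq> x \<and> dif x y = m \<and> y < f m \<and> w \<in> reach f X y s \<and> agree s y z"
    if w: "w \<in> reach f X x k" "agree s z w" for w
    using w(1)
  proof (cases rule: reach_cases)
    case 1
    then have "agree (Suc m) x z"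
      using agree_sym[OF agree_mono[OF w(2), of "Suc m"]] ms by simp
    then show ?thesis using zx by (simp add: m_def agree_iff_le_dif)
  next
    case (2 y)
    let ?m = "dif x y"
    have yw: "agree (sep (f ?m)) y w" using reach_agree[OF f 2(5)] .
    have lt: "?m < sep (f ?m)"
      using less_sep[of "f ?m"] strict_mono_imp_increasing[OF f, of ?m] by linarith
    have "agree ?m x y" using 2(2) by (simp add: agree_iff_le_dif)
    moreover have "\<sigma> x ?m \<noteq> \<sigma> y ?m" using 2(2) dif_differs[of x y] by auto
    ultimately have "agree ?m x w" "\<sigma> x ?m \<noteq> \<sigma> w ?m"
      using yw lt by (auto simp: agree_def)
    then have "dif x w = ?m" by (rule dif_eqI)
    moreover have "dif x w = m"
    proof (rule dif_eqI)
      have "agree m x z" "\<sigma> x m \<noteq> \<sigma> z m"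
        using zx dif_differs[of x z] by (auto simp: m_def agree_iff_le_dif)
      with w(2) ms show "agree m x w" "\<sigma> x m \<noteq> \<sigma> w m" by (auto simp: agree_def)
    qed
    ultimately have "?m = m" by simp
    moreover have "agree s y z"
      using agree_trans[OF yw, of z] w(2) \<open>?m = m\<close> by (simp add: s_def agree_sym)
    ultimately show ?thesis using 2 by (auto simp: s_def)
  qed
  show ?case
  proof (cases "\<exists>y\<in>X. y \<noteq> x \<and> dif x y = m \<and> y < f m \<and> agree s y z")
    case False
    then show ?thesis using child by blast
  next
    case True
    then obtain y where y: "y \<in> X" "y \<noteq> x" "dif x y = m" "y < f m" "agree s y z" by blast
    have zn: "z \<notin> reach f X y s"
      using less.prems(2) reach_step[of y X x k f z] y km by (auto simp: s_def)
    then have "z \<noteq> y" using reach_root by auto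
    then have "f m \<le> z" using sep_agree_imp_eq[of y "f m" z] y by (fastforce simp: s_def)
    then have "Suc z - s < Suc z - k" using ms km by linarith
    from less.hyps[OF this y(5) zn] obtain n where n: "\<And>w. w \<in> reach f X y s \<Longrightarrow> \<not> agree n z w"
      by blast
    have "\<not> agree (max n s) z w" if w: "w \<in> reach f X x k" for w
    proof
      assume a: "agree (max n s) z w"
      then obtain y' where y': "y' < f m" "w \<in> reach f X y' s" "agree s y' z"
        using child[OF w] agree_mono[OF a, of s] by auto
      have "agree s y' y" using y'(3) y(5) agree_trans agree_sym by blast
      then have "y' = y" using sep_agree_imp_eq y' y by (auto simp: s_def)
      with n[of w] y' agree_mono[OF a, of n] show False by auto
    qed
    then show ?thesis by blast
  qed
qed

lemma thin_closed:
  assumes "strict_mono f" "z \<notin> thin f X"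
  shows "\<exists>n. \<forall>w\<in>thin f X. \<not> agree n z w"
proof -
  have "agree 0 0 z" by (simp add: agree_def)
  from reach_closed[OF assms(1) this] assms(2) show ?thesis by (simp add: thin_def)
qed

section \<open>Thinning by an undominated function keeps sets crowded\<close>

lemma desc_crowd:
  assumes C: "\<And>x N. x \<in> C \<Longrightarrow> \<exists>y\<in>C. y \<noteq> x \<and> agree N x y \<and> y < f (dif x y)"
  shows "desc f C n x k z \<Longrightarrow> x \<in> C \<Longrightarrow> \<exists>w\<in>reach f C x k. w \<noteq> z \<and> agree N z w"
proof -
  \<comment> \<open>The new child of \<open>x\<close> is close enough to respect both the precision
    \<open>N\<close> and the radius \<open>k\<close>; the induction then carries this along the
    branch leading to \<open>z\<close>.\<close>
  have root: "\<exists>w\<in>reach f C x k. w \<noteq> x \<and> agree N x w" if x: "x \<in> C" for x k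
  proof -
    obtain y where y: "y \<in> C" "y \<noteq> x" "agree (max N k) x y" "y < f (dif x y)"
      using C[OF x, of "max N k"] by blast
    have "k \<le> dif x y" using y(2,3) agree_iff_le_dif[of x y] by simp
    then have "y \<in> reach f C x k" by (rule reach_step[of y C x k f y, OF y(1,2) _ y(4) reach_root])
    with y show ?thesis using agree_mono[OF y(3), of N] by auto
  qed
  show "desc f C n x k z \<Longrightarrow> x \<in> C \<Longrightarrow> \<exists>w\<in>reach f C x k. w \<noteq> z \<and> agree N z w"
  proof (induction n arbitrary: x k)
  case 0
  with root show ?case by simp
next
  case (Suc n)
  show ?case
  proof (cases "z = x")
    case True
    with root Suc.prems show ?thesis by simp
  next
    case False
    with Suc.prems obtain y where "y \<in> C" "y \<noteq> x" "k \<le> dif x y" "y < f (dif x y)"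
      "desc f C n y (sep (f (dif x y))) z" by auto
    with Suc.IH[OF this(5) this(1)] show ?thesis using reach_step by blast
  qed
qed
qed

text \<open>The bound \<open>h m\<close> dominates the chosen neighbours in \<open>C\<close>,
  agreeing up to \<open>m\<close>, of all points \<open>x \<le> m\<close> of \<open>C\<close>. Where
  \<open>h m < f m\<close>, such a neighbour \<open>y\<close> is an admissible child, as
  \<open>y < f m \<le> f (dif x y)\<close>; non-domination supplies such \<open>m\<close> beyond any
  \<open>x\<close> and any precision.\<close>

lemma thin_crowd_adequate:
  assumes "crowd C" "0 \<in> C"
  shows "\<exists>h. \<forall>f. strict_mono f \<and> \<not> f \<le>\<^sup>* h \<longrightarrow> crowd (thin f C)"
proof -
  define e where "e x m = (SOME y. y \<in> C \<and> y \<noteq> x \<and> agree m x y)" for x m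
  have e: "e x m \<in> C \<and> e x m \<noteq> x \<and> agree m x (e x m)" if "x \<in> C" for x m
    unfolding e_def by (rule someI_ex) (use assms(1) that in \<open>auto simp: crowd_def\<close>)
  define h where "h m = (\<Sum>x\<le>m. e x m)" for m
  have "crowd (thin f C)" if f: "strict_mono f" "\<not> f \<le>\<^sup>* h" for f
  proof -
    have "\<exists>y\<in>C. y \<noteq> x \<and> agree N x y \<and> y < f (dif x y)" if x: "x \<in> C" for x N
    proof -
      obtain m where m: "m \<ge> max x N" "h m < f m"
        using f(2) unfolding le_star_def eventually_sequentially by (meson not_le)
      let ?y = "e x m"
      have "?y \<le> h m" unfolding h_def using m by (intro member_le_sum) auto
      moreover have "f m \<le> f (dif x ?y)"
        using e[OF x, of m] f(1) by (auto simp: strict_mono_less_eq agree_iff_le_dif)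
      ultimately have "?y < f (dif x ?y)" using m by linarith
      moreover have "agree N x ?y" using agree_mono[of m x ?y N] e[OF x, of m] m by auto
      ultimately show ?thesis using e[OF x, of m] by blast
    qed
    note desc_crowd[OF this]
    then show ?thesis unfolding crowd_def thin_def
      using assms(2) unfolding reach_def[of f C 0 0] by (fastforce simp: reach_def)
  qed
  then show ?thesis by blast
qed

section \<open>Perfect kernels and the partition property of rich sets\<close>

lemma crowd_Un: "(\<And>C. C \<in> \<C> \<Longrightarrow> crowd C) \<Longrightarrow> crowd (\<Union>\<C>)"
  unfolding crowd_def by blast

definition kernel :: "nat set \<Rightarrow> nat set" where
  "kernel X = \<Union>{C. crowd C \<and> C \<subseteq> X}"

lemma crowd_kernel: "crowd (kernel X)"
  unfolding kernel_def by (rule crowd_Un) auto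

lemma kernel_subset: "kernel X \<subseteq> X"
  unfolding kernel_def by auto

lemma kernel_greatest: "crowd C \<Longrightarrow> C \<subseteq> X \<Longrightarrow> C \<subseteq> kernel X"
  unfolding kernel_def by auto

lemma rich_mono: "rich X \<Longrightarrow> X \<subseteq> Y \<Longrightarrow> rich Y"
  unfolding rich_def by blast

lemma rich_iff_kernel: "rich X \<longleftrightarrow> 0 \<in> kernel (insert 0 X)"
  unfolding rich_def kernel_def by blast

lemma crowd_ball: "crowd C \<Longrightarrow> crowd {y\<in>C. agree n x y}"
  unfolding crowd_def
proof (intro ballI allI)
  fix y m assume C: "\<forall>x\<in>C. \<forall>n. \<exists>y\<in>C. y \<noteq> x \<and> agree n x y" and y: "y \<in> {y\<in>C. agree n x y}"
  then obtain z where "z \<in> C" "z \<noteq> y" "agree (max m n) y z" by blast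
  with y show "\<exists>z\<in>{y\<in>C. agree n x y}. z \<noteq> y \<and> agree m y z"
    using agree_mono[of "max m n" y z] agree_trans[of n x y z] by auto
qed

lemma crowd_remove: "crowd C \<Longrightarrow> crowd (C - {p})"
  unfolding crowd_def
proof (intro ballI allI)
  fix x n assume C: "\<forall>x\<in>C. \<forall>n. \<exists>y\<in>C. y \<noteq> x \<and> agree n x y" and x: "x \<in> C - {p}"
  then obtain y where "y \<in> C" "y \<noteq> x" "agree (max n (Suc (dif x p))) x y" by blast
  with x show "\<exists>y\<in>C - {p}. y \<noteq> x \<and> agree n x y"
    using agree_mono[of "max n (Suc (dif x p))" x y] agree_iff_le_dif[of x p "Suc (dif x p)"]
    by (intro bexI[of _ y]) auto
qed

text \<open>If \<open>C \<inter> A\<close> has an isolated point, then near it \<open>C\<close>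
  meets \<open>A\<close> in that point only; deleting it from the ball leaves a crowded subset of
  \<open>B\<close>.\<close>

lemma crowd_split:
  assumes "crowd C" "C \<noteq> {}" "C \<subseteq> A \<union> B"
  shows "\<exists>D\<subseteq>C. D \<noteq> {} \<and> crowd D \<and> (D \<subseteq> A \<or> D \<subseteq> B)"
proof (cases "crowd (C \<inter> A)")
  case True
  then show ?thesis using assms by (cases "C \<inter> A = {}") blast+
next
  case False
  then obtain x n where x: "x \<in> C" "x \<in> A" "\<And>y. y \<in> C \<inter> A \<Longrightarrow> y \<noteq> x \<Longrightarrow> \<not> agree n x y"
    unfolding crowd_def by blast
  let ?D = "{y\<in>C. agree n x y} - {x}"
  have "?D \<noteq> {}" using assms(1) x(1) unfolding crowd_def by blast
  moreover have "crowd ?D" by (intro crowd_remove crowd_ball assms)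
  moreover have "?D \<subseteq> B" using x(3) assms(3) by blast
  ultimately show ?thesis by (intro exI[of _ ?D]) auto
qed

text \<open>Partition regularity, the source of the ultrafilters. The kernel of a set that is not
  rich stays away from \<open>0\<close>, since otherwise \<open>0\<close> could be added to it.
  Splitting a crowded set close to \<open>0\<close> would put a point of one of the two kernels too
  near to \<open>0\<close>.\<close>

lemma rich_Un:
  assumes "rich (A \<union> B)" shows "rich A \<or> rich B"
proof (rule ccontr)
  assume "\<not> (rich A \<or> rich B)"
  then have "\<not> rich A" "\<not> rich B" by auto
  have *: "\<exists>n. \<forall>x\<in>kernel X. \<not> agree n 0 x" if "\<not> rich X" for X
  proof (rule ccontr)
    assume "\<nexists>n. \<forall>x\<in>kernel X. \<not> agree n 0 x"
    then have "\<exists>x\<in>kernel X. agree n 0 x" for n by blast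
    moreover have "0 \<notin> kernel X" using that kernel_subset crowd_kernel unfolding rich_def by blast
    ultimately have "crowd (insert 0 (kernel X))"
      using crowd_kernel[of X] unfolding crowd_def by (metis insert_iff)
    then show False using that kernel_subset[of X] unfolding rich_def by blast
  qed
  obtain n m where n: "\<And>x. x \<in> kernel A \<Longrightarrow> \<not> agree n 0 x" and m: "\<And>x. x \<in> kernel B \<Longrightarrow> \<not> agree m 0 x"
    using *[OF \<open>\<not> rich A\<close>] *[OF \<open>\<not> rich B\<close>] by blast
  obtain C where C: "crowd C" "0 \<in> C" "C \<subseteq> insert 0 (A \<union> B)" using assms rich_def by blast
  let ?D = "{y\<in>C. agree (max n m) 0 y} - {0}"
  have "?D \<noteq> {}" using C unfolding crowd_def by blast
  moreover have "crowd ?D" by (intro crowd_remove crowd_ball C)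
  ultimately obtain D where D: "D \<subseteq> ?D" "D \<noteq> {}" "crowd D" "D \<subseteq> A \<or> D \<subseteq> B"
    using crowd_split[of ?D A B] C(3) by blast
  then obtain x where "x \<in> D" "agree n 0 x" "agree m 0 x"
    using agree_mono[of "max n m" 0] by fastforce
  then show False using D n m kernel_greatest by blast
qed

lemma not_rich_finite: "finite X \<Longrightarrow> \<not> rich X"
proof
  assume "finite X" "rich X"
  then obtain C where C: "crowd C" "0 \<in> C" "C \<subseteq> insert 0 X" unfolding rich_def by blast
  then have "finite C" using \<open>finite X\<close> by (meson finite.insertI finite_subset)
  define n where "n = Suc (\<Sum>y\<in>C. dif 0 y)"
  obtain y where y: "y \<in> C" "y \<noteq> 0" "agree n 0 y" using C unfolding crowd_def by blast
  have "dif 0 y < n" unfolding n_def using \<open>finite C\<close> y member_le_sum[of y C "dif 0"] by auto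
  then show False using y agree_iff_le_dif[of 0 y n] by auto
qed

text \<open>A limit of the kernel belongs to the closed set \<open>X\<close>, and adding it keeps
  the kernel crowded, so maximality absorbs it.\<close>

lemma kernel_closed:
  assumes X: "\<And>z. z \<notin> X \<Longrightarrow> \<exists>n. \<forall>w\<in>X. \<not> agree n z w" and z: "z \<notin> kernel X"
  shows "\<exists>n. \<forall>w\<in>kernel X. \<not> agree n z w"
proof (rule ccontr)
  assume *: "\<nexists>n. \<forall>w\<in>kernel X. \<not> agree n z w"
  then have "z \<in> X" using X kernel_subset by blast
  have "crowd (insert z (kernel X))"
    using crowd_kernel[of X] * z unfolding crowd_def by (metis insert_iff)
  then show False using z kernel_greatest[of "insert z (kernel X)" X] \<open>z \<in> X\<close> kernel_subset by blast
qed

section \<open>Maximal families with rich finite intersections\<close>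

definition fir :: "nat set set \<Rightarrow> bool" where
  "fir \<V> \<longleftrightarrow> (\<forall>F. finite F \<and> F \<subseteq> \<V> \<longrightarrow> rich (\<Inter>F))"

text \<open>Zorn's lemma gives a maximal family, and \<open>rich_Un\<close> makes it decide every
  cover. Covers replace complements because the coded sets to be compared both contain
  \<open>0\<close>.\<close>

lemma fir_extend:
  assumes "fir \<V>"
  shows "\<exists>\<W>. \<V> \<subseteq> \<W> \<and> fir \<W> \<and> (\<forall>A B. A \<union> B = UNIV \<longrightarrow> A \<in> \<W> \<or> B \<in> \<W>)"
proof -
  let ?Z = "{\<W>. \<V> \<subseteq> \<W> \<and> fir \<W>}"
  have "\<exists>U\<in>?Z. \<forall>X\<in>\<C>. X \<subseteq> U" if "\<C> \<in> chains ?Z" for \<C>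
  proof (cases "\<C> = {}")
    case True then show ?thesis using assms by blast
  next
    case False
    have "fir (\<Union>\<C>)" unfolding fir_def
    proof safe
      fix F assume F: "finite F" "F \<subseteq> \<Union>\<C>"
      have "\<exists>X\<in>\<C>. F \<subseteq> X"
        using finite_subset_Union_chain[OF F False] that by (force simp: chains_def chain_subset_def subset_chain_def)
      then show "rich (\<Inter>F)" using F that unfolding chains_def fir_def by blast
    qed
    moreover have "\<V> \<subseteq> \<Union>\<C>" using False that unfolding chains_def by blast
    ultimately show ?thesis by blast
  qed
  then obtain \<W> where W: "\<V> \<subseteq> \<W>" "fir \<W>" "\<And>X. X \<in> ?Z \<Longrightarrow> \<W> \<subseteq> X \<Longrightarrow> X = \<W>"
    using Zorn_Lemma2[of ?Z] by auto
  have *: "\<exists>F. finite F \<and> F \<subseteq> \<W> \<and> \<not> rich (\<Inter>F \<inter> A)" if "A \<notin> \<W>" for A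
  proof -
    have "\<not> fir (insert A \<W>)" using W(3)[of "insert A \<W>"] W(1) that by blast
    then obtain F where F: "finite F" "F \<subseteq> insert A \<W>" "\<not> rich (\<Inter>F)" unfolding fir_def by blast
    have "\<not> rich (\<Inter>(F - {A}) \<inter> A)" using F(3) rich_mono[of "\<Inter>(F - {A}) \<inter> A" "\<Inter>F"] by blast
    with F show ?thesis by (intro exI[of _ "F - {A}"]) auto
  qed
  have "A \<in> \<W> \<or> B \<in> \<W>" if "A \<union> B = UNIV" for A B
  proof (rule ccontr)
    assume "\<not> (A \<in> \<W> \<or> B \<in> \<W>)"
    then obtain F G where F: "finite F" "F \<subseteq> \<W>" "\<not> rich (\<Inter>F \<inter> A)"
      and G: "finite G" "G \<subseteq> \<W>" "\<not> rich (\<Inter>G \<inter> B)" using * by meson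
    have "rich (\<Inter>(F \<union> G))" using W(2) F G unfolding fir_def by blast
    moreover have "\<Inter>(F \<union> G) \<subseteq> (\<Inter>F \<inter> A) \<union> (\<Inter>G \<inter> B)" using that by auto
    ultimately show False using rich_Un rich_mono F(3) G(3) by blast
  qed
  with W show ?thesis by blast
qed

end

section \<open>Projective and adequate thinning relations\<close>

definition baire_measure :: "nat \<Rightarrow> (nat \<Rightarrow> nat \<Rightarrow> nat) measure" where
  "baire_measure k = sigma (topspace (baire_power k)) {U. openin (baire_power k) U}"

lemma topspace_baire_power: "topspace (baire_power k) = ({..<k} \<rightarrow>\<^sub>E UNIV)"
  by (simp add: baire_power_def)

lemma sets_baire_measure:
  "sets (baire_measure k) = sigma_sets (topspace (baire_power k)) {U. openin (baire_power k) U}"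
  unfolding baire_measure_def by (rule sets_measure_of) (auto dest: openin_subset)

lemma space_baire_measure: "space (baire_measure k) = topspace (baire_power k)"
  unfolding baire_measure_def by (rule space_measure_of) (auto dest: openin_subset)

lemma measurable_baire_coordinate:
  assumes "i < k"
  shows "(\<lambda>w. w i m) \<in> measurable (baire_measure k) (count_space (UNIV :: nat set))"
proof -
  have "(\<lambda>w. w i m) -` {j} \<inter> space (baire_measure k) \<in> sets (baire_measure k)" for j
  proof -
    have "open ((\<lambda>f. f m) -` {j} :: (nat \<Rightarrow> nat) set)"
      by (intro open_vimage continuous_on_product_coordinates) (auto simp: open_discrete)
    moreover have "continuous_map (baire_power k) euclidean (\<lambda>w. w i)"
      unfolding baire_power_def using assms by (intro continuous_map_product_projection) auto
    ultimately have "openin (baire_power k) {w \<in> topspace (baire_power k). w i \<in> (\<lambda>f. f m) -` {j}}"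
      by (intro openin_continuous_map_preimage) auto
    moreover have "(\<lambda>w. w i m) -` {j} \<inter> space (baire_measure k)
        = {w \<in> topspace (baire_power k). w i \<in> (\<lambda>f. f m) -` {j}}"
      by (auto simp: space_baire_measure)
    ultimately show ?thesis by (simp add: sets_baire_measure sigma_sets.Basic)
  qed
  then show ?thesis by (subst measurable_count_space_eq2_countable) auto
qed

lemma projective_pred:
  assumes "Measurable.pred (baire_measure k) P"
  shows "projective k {w \<in> topspace (baire_power k). P w}"
proof (rule projective.borel)
  show "{w \<in> topspace (baire_power k). P w} \<in> sigma_sets (topspace (baire_power k)) {U. openin (baire_power k) U}"
    using predE[OF assms] by (simp add: space_baire_measure sets_baire_measure)
qed

lemma projective_Not:
  assumes "projective k {w \<in> topspace (baire_power k). P w}"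
  shows "projective k {w \<in> topspace (baire_power k). \<not> P w}"
proof -
  have "{w \<in> topspace (baire_power k). \<not> P w}
      = topspace (baire_power k) - {w \<in> topspace (baire_power k). P w}" by auto
  then show ?thesis using projective.compl[OF assms] by simp
qed

lemma projective_Ex:
  assumes "projective (Suc k) {w \<in> topspace (baire_power (Suc k)). P w}"
  shows "projective k {w \<in> topspace (baire_power k). \<exists>c. P (w(k := c))}"
proof -
  have "{w \<in> topspace (baire_power k). \<exists>c. P (w(k := c))}
      = (\<lambda>w. restrict w {..<k}) ` {w \<in> topspace (baire_power (Suc k)). P w}" (is "?L = ?R")
  proof (intro equalityI subsetI)
    fix w assume "w \<in> ?L"
    then obtain c where c: "w \<in> {..<k} \<rightarrow>\<^sub>E UNIV" "P (w(k := c))" by (auto simp: topspace_baire_power)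
    have "w(k := c) \<in> {..<Suc k} \<rightarrow>\<^sub>E UNIV" using c(1) by (auto simp: PiE_def extensional_def)
    moreover have "w = restrict (w(k := c)) {..<k}"
      using c(1) by (auto simp: PiE_def extensional_def restrict_def)
    ultimately show "w \<in> ?R" using c(2)
      by (intro image_eqI[of _ _ "w(k := c)"]) (auto simp: topspace_baire_power)
  next
    fix w assume "w \<in> ?R"
    then obtain v where v: "v \<in> {..<Suc k} \<rightarrow>\<^sub>E UNIV" "P v" "w = restrict v {..<k}"
      by (auto simp: topspace_baire_power)
    have "w(k := v k) = v" using v(1,3) by (auto simp: fun_eq_iff PiE_def extensional_def)
    then have "\<exists>c. P (w(k := c))" using v(2) by metis
    moreover have "w \<in> topspace (baire_power k)" using v(3) by (auto simp: topspace_baire_power)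
    ultimately show "w \<in> ?L" by simp
  qed
  then show ?thesis using projective.proj[OF assms] by simp
qed

text \<open>A real codes the set of its zeros. Adding \<open>0\<close> puts the root in every coded
  set, so that exactly the sets containing \<open>0\<close> are coded.\<close>

definition coded :: "(nat \<Rightarrow> nat) \<Rightarrow> nat set" where
  "coded x = insert 0 {i. x i = 0}"

lemma coded_surj: "0 \<in> C \<Longrightarrow> \<exists>c. coded c = C"
  by (rule exI[of _ "\<lambda>i. if i \<in> C then 0 else 1"]) (auto simp: coded_def)

section \<open>The thinning relation is projective and adequate\<close>

context cantor_points
begin

text \<open>Turns the quantifier over sets in \<open>rich\<close> into one over reals, which a
  projection can express.\<close>

lemma rich_iff_coded:
  assumes "0 \<in> X"
  shows "rich X \<longleftrightarrow> (\<exists>c. crowd (coded c) \<and> coded c \<subseteq> X)"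
proof
  assume "rich X"
  then obtain C where C: "crowd C" "0 \<in> C" "C \<subseteq> X" using assms unfolding rich_def by blast
  then show "\<exists>c. crowd (coded c) \<and> coded c \<subseteq> X" using coded_surj[OF C(2)] by blast
next
  assume "\<exists>c. crowd (coded c) \<and> coded c \<subseteq> X"
  then show "rich X" unfolding rich_def by (auto simp: coded_def)
qed

text \<open>The functions in \<open>hs\<close> come from lower levels: coordinates below
  \<open>length hs\<close> enter with their thinning performed, the remaining ones up to
  \<open>n\<close> are still to be thinned.\<close>

definition before :: "nat \<Rightarrow> (nat \<Rightarrow> nat) list \<Rightarrow> (nat \<Rightarrow> nat \<Rightarrow> nat) \<Rightarrow> nat set" where
  "before n hs x = (\<Inter>i\<le>n. if i < length hs then thin (hs ! i) (coded (x i)) else coded (x i))"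

definition after :: "nat \<Rightarrow> (nat \<Rightarrow> nat) list \<Rightarrow> (nat \<Rightarrow> nat \<Rightarrow> nat) \<Rightarrow> nat set" where
  "after n hs x = (\<Inter>i\<le>n. thin (if i < length hs then hs ! i else x (Suc n)) (coded (x i)))"

text \<open>The last coordinate \<open>x (n + 1)\<close> is the function applied to the sets not yet thinned.\<close>

definition thinning_rel :: "nat \<Rightarrow> (nat \<Rightarrow> nat) list \<Rightarrow> (nat \<Rightarrow> nat \<Rightarrow> nat) set" where
  "thinning_rel n hs = {x \<in> topspace (baire_power (n + 2)). rich (before n hs x) \<longrightarrow> rich (after n hs x)}"

lemma zero_in_before: "0 \<in> before n hs x"
  by (auto simp: before_def zero_in_thin coded_def)

lemma zero_in_after: "0 \<in> after n hs x"
  by (auto simp: after_def zero_in_thin)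

lemma measurable_coded:
  "i < k \<Longrightarrow> Measurable.pred (baire_measure k) (\<lambda>w. z \<in> coded (w i))"
  unfolding coded_def using measurable_baire_coordinate[of i k z] by simp

lemma measurable_desc:
  assumes f [measurable]: "\<And>m. (\<lambda>w. f w m) \<in> measurable M (count_space UNIV)"
    and X [measurable]: "\<And>z. Measurable.pred M (\<lambda>w. z \<in> X w)"
  shows "Measurable.pred M (\<lambda>w. desc (f w) (X w) n x k z)"
proof (induction n arbitrary: x k)
  case (Suc n)
  note Suc [measurable]
  \<comment> \<open>Naming the value \<open>f w (dif x y)\<close> as \<open>j\<close> turns the
    radius into a constant, so the induction hypothesis applies inside a countable union.\<close>
  have eq: "desc (f w) (X w) (Suc n) x k z \<longleftrightarrow> z = x \<or>
     (\<exists>y. y \<in> X w \<and> y \<noteq> x \<and> k \<le> dif x y \<and>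
        (\<exists>j. f w (dif x y) = j \<and> y < j \<and> desc (f w) (X w) n y (sep j) z))" for w
    by auto
  show ?case unfolding eq by measurable
qed simp

lemma measurable_thin:
  assumes [measurable]: "\<And>m. (\<lambda>w. f w m) \<in> measurable M (count_space UNIV)"
    and [measurable]: "\<And>z. Measurable.pred M (\<lambda>w. z \<in> X w)"
  shows "Measurable.pred M (\<lambda>w. z \<in> thin (f w) (X w))"
proof -
  note measurable_desc[OF assms, measurable]
  have eq: "z \<in> thin (f w) (X w) \<longleftrightarrow> (\<exists>n. desc (f w) (X w) n 0 0 z)" for w
    by (simp add: thin_def reach_def)
  show ?thesis unfolding eq by measurable
qed

lemma measurable_crowd:
  assumes [measurable]: "\<And>z. Measurable.pred M (\<lambda>w. z \<in> X w)"
  shows "Measurable.pred M (\<lambda>w. crowd (X w))"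
proof -
  have eq: "crowd (X w) \<longleftrightarrow> (\<forall>x. x \<in> X w \<longrightarrow> (\<forall>n. \<exists>y. y \<in> X w \<and> y \<noteq> x \<and> agree n x y))" for w
    unfolding crowd_def by blast
  show ?thesis unfolding eq by measurable
qed

lemma measurable_subset:
  assumes [measurable]: "\<And>z :: nat. Measurable.pred M (\<lambda>w. z \<in> X w)" "\<And>z. Measurable.pred M (\<lambda>w. z \<in> Y w)"
  shows "Measurable.pred M (\<lambda>w. X w \<subseteq> Y w)"
  unfolding subset_eq Ball_def by measurable

lemma measurable_before:
  assumes "n < k" shows "Measurable.pred (baire_measure k) (\<lambda>w. z \<in> before n hs w)"
proof -
  have *: "Measurable.pred (baire_measure k)
      (\<lambda>w. z \<in> (if i < length hs then thin (hs ! i) (coded (w i)) else coded (w i)))" if "i \<le> n" for i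
  proof (cases "i < length hs")
    case True
    have "Measurable.pred (baire_measure k) (\<lambda>w. z \<in> thin (hs ! i) (coded (w i)))"
      by (rule measurable_thin) (use that assms measurable_coded in simp_all)
    with True show ?thesis by simp
  next
    case False
    with that assms show ?thesis by (simp add: measurable_coded)
  qed
  have eq: "z \<in> before n hs w \<longleftrightarrow>
      (\<forall>i. i \<le> n \<longrightarrow> z \<in> (if i < length hs then thin (hs ! i) (coded (w i)) else coded (w i)))" for w
    by (auto simp: before_def)
  show ?thesis unfolding eq
  proof (rule pred_intros_countable(1))
    show "Measurable.pred (baire_measure k) (\<lambda>w. i \<le> n \<longrightarrow> z \<in> (if i < length hs then thin (hs ! i) (coded (w i)) else coded (w i)))" for i
      using *[of i] by (cases "i \<le> n") auto
  qed
qed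

lemma measurable_after:
  assumes "Suc n < k" shows "Measurable.pred (baire_measure k) (\<lambda>w. z \<in> after n hs w)"
proof -
  have *: "Measurable.pred (baire_measure k)
      (\<lambda>w. z \<in> thin (if i < length hs then hs ! i else w (Suc n)) (coded (w i)))" if "i \<le> n" for i
    by (rule measurable_thin, cases "i < length hs")
      (use that assms measurable_coded measurable_baire_coordinate in simp_all)
  have eq: "z \<in> after n hs w \<longleftrightarrow>
      (\<forall>i. i \<le> n \<longrightarrow> z \<in> thin (if i < length hs then hs ! i else w (Suc n)) (coded (w i)))" for w
    by (auto simp: after_def)
  show ?thesis unfolding eq
  proof (rule pred_intros_countable(1))
    show "Measurable.pred (baire_measure k) (\<lambda>w. i \<le> n \<longrightarrow> z \<in> thin (if i < length hs then hs ! i else w (Suc n)) (coded (w i)))" for i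
      using *[of i] by (cases "i \<le> n") auto
  qed
qed

lemma projective_thinning_rel: "projective (n + 2) (thinning_rel n hs)"
proof -
  \<comment> \<open>Coordinate \<open>n + 2\<close> is a candidate witness \<open>d\<close> for
    richness of \<open>after\<close>, coordinate \<open>n + 3\<close> a candidate witness
    \<open>c\<close> for \<open>before\<close>; the relation becomes
    \<open>\<exists>d. \<forall>c. Q\<close>, a projection of the complement of a
    projection.\<close>
  define Q where "Q w \<longleftrightarrow> \<not> (crowd (coded (w (Suc (n + 2)))) \<and> coded (w (Suc (n + 2))) \<subseteq> before n hs w) \<or>
      (crowd (coded (w (n + 2))) \<and> coded (w (n + 2)) \<subseteq> after n hs w)" for w
  have "Measurable.pred (baire_measure (Suc (Suc (n + 2)))) (\<lambda>w. \<not> Q w)"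
    unfolding Q_def
    by (intro pred_intros_logic measurable_crowd measurable_subset measurable_coded
        measurable_before measurable_after) auto
  from projective_Ex[OF projective_Not[OF projective_Ex[OF projective_pred[OF this]]]]
  have "projective (n + 2) {w \<in> topspace (baire_power (n + 2)).
      \<exists>d. \<not> (\<exists>c. \<not> Q (w(n + 2 := d, Suc (n + 2) := c)))}" .
  moreover have "(\<exists>d. \<not> (\<exists>c. \<not> Q (w(n + 2 := d, Suc (n + 2) := c)))) \<longleftrightarrow>
      (rich (before n hs w) \<longrightarrow> rich (after n hs w))" for w
  proof -
    have "before n hs (w(n + 2 := d, Suc (n + 2) := c)) = before n hs w"
      "after n hs (w(n + 2 := d, Suc (n + 2) := c)) = after n hs w" for c d
      unfolding before_def after_def by (intro INF_cong refl; simp)+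
    then show ?thesis
      unfolding Q_def rich_iff_coded[OF zero_in_before] rich_iff_coded[OF zero_in_after] by auto
  qed
  ultimately show ?thesis by (simp add: thinning_rel_def)
qed

text \<open>A crowded set witnessing richness of \<open>before\<close> stays crowded when thinned by
  any increasing \<open>g\<close> not dominated by its bound \<open>h\<close>. The result lies in
  the sets thinned by \<open>hs\<close> because thinning stays inside the witness, and in the others
  because thinning is monotone.\<close>

lemma adequate_thinning_rel: "adequate (n + 1) (thinning_rel n hs)"
  unfolding adequate_def
proof
  fix x :: "nat \<Rightarrow> nat \<Rightarrow> nat" assume "x \<in> {..<n + 1} \<rightarrow>\<^sub>E UNIV"
  have eq: "before n hs (tuple_snoc (n + 1) x g) = before n hs x" for g
    by (auto simp: before_def tuple_snoc_def)
  have top: "tuple_snoc (n + 1) x g \<in> topspace (baire_power (n + 2))" for g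
    by (auto simp: tuple_snoc_def topspace_baire_power)
  show "\<exists>h. \<forall>g. strict_mono g \<and> \<not> g \<le>\<^sup>* h \<longrightarrow> tuple_snoc (n + 1) x g \<in> thinning_rel n hs"
  proof (cases "rich (before n hs x)")
    case False
    then show ?thesis using top eq by (auto simp: thinning_rel_def)
  next
    case True
    then obtain c where c: "crowd (coded c)" "coded c \<subseteq> before n hs x"
      using rich_iff_coded[OF zero_in_before] by blast
    obtain h where h: "\<And>g. strict_mono g \<Longrightarrow> \<not> g \<le>\<^sup>* h \<Longrightarrow> crowd (thin g (coded c))"
      using thin_crowd_adequate[OF c(1)] by (auto simp: coded_def)
    have "tuple_snoc (n + 1) x g \<in> thinning_rel n hs" if g: "strict_mono g" "\<not> g \<le>\<^sup>* h" for g
    proof -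
      have "thin g (coded c) \<subseteq> after n hs (tuple_snoc (n + 1) x g)"
        unfolding after_def
      proof (rule INT_greatest)
        fix i assume "i \<in> {..n}"
        then have i: "tuple_snoc (n + 1) x g i = x i" "tuple_snoc (n + 1) x g (Suc n) = g"
          by (auto simp: tuple_snoc_def)
        have ci: "coded c \<subseteq> (if i < length hs then thin (hs ! i) (coded (x i)) else coded (x i))"
          using c(2) \<open>i \<in> {..n}\<close> unfolding before_def by blast
        have "thin g (coded c) \<subseteq> coded c" using thin_subset[of g "coded c"] by (auto simp: coded_def)
        then show "thin g (coded c) \<subseteq> thin (if i < length hs then hs ! i else tuple_snoc (n + 1) x g (Suc n))
            (coded (tuple_snoc (n + 1) x g i))"
          unfolding i using ci thin_mono[of "coded c" "coded (x i)" g] by (auto split: if_splits)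
      qed
      then have "rich (after n hs (tuple_snoc (n + 1) x g))"
        using h[OF g] zero_in_thin unfolding rich_def by blast
      then show ?thesis using top by (simp add: thinning_rel_def)
    qed
    then show ?thesis by blast
  qed
qed

end

section \<open>The rationals and a point at infinity\<close>

text \<open>Index \<open>0\<close> is reserved for infinity. Truncated subtraction gives
  \<open>rat_point 0 = rat_point 1\<close>, so injectivity is claimed for nonzero indices.\<close>

definition rat_point :: "nat \<Rightarrow> real" where
  "rat_point i = from_nat_into \<rat> (i - 1)"

text \<open>A translate of the rationals by a fixed irrational: the cuts are dense but never
  rational, so each one splits the rationals into two open sets.\<close>

definition rat_cut :: "nat \<Rightarrow> real" where
  "rat_cut j = (SOME t. t \<notin> \<rat>) + from_nat_into \<rat> j"

text \<open>
  Point \<open>0\<close> is above all cuts, and point \<open>i + 1\<close> is the \<open>i\<close>-th rational. The root must not be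
  rational: every closed set of the ultrafilter contains the limit of the ultrafilter.
\<close>

definition rat_code :: "nat \<Rightarrow> nat \<Rightarrow> bool" where
  "rat_code i j \<longleftrightarrow> i = 0 \<or> rat_cut j < rat_point i"

section \<open>Separating rationals by irrational cuts\<close>

lemma rat_cut_irrational: "rat_cut j \<notin> \<rat>"
proof
  have "\<exists>t :: real. t \<notin> \<rat>" using uncountable_UNIV_real countable_rat by (metis UNIV_eq_I)
  then have "(SOME t :: real. t \<notin> \<rat>) \<notin> \<rat>" by (rule someI_ex)
  moreover assume "rat_cut j \<in> \<rat>"
  then have "rat_cut j - from_nat_into \<rat> j \<in> \<rat>"
    by (intro Rats_diff from_nat_into) auto
  ultimately show False by (simp add: rat_cut_def)
qed

lemma rat_point_Rats: "rat_point i \<in> \<rat>"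
  unfolding rat_point_def by (rule from_nat_into) auto

lemma rat_enum: "bij_betw (from_nat_into (\<rat> :: real set)) UNIV \<rat>"
  by (rule bij_betw_from_nat_into) (auto simp: countable_rat Rats_infinite)

lemma rat_point_inj: "rat_point i = rat_point j \<Longrightarrow> i \<noteq> 0 \<Longrightarrow> j \<noteq> 0 \<Longrightarrow> i = j"
  using injD[OF bij_betw_imp_inj_on[OF rat_enum], of "i - 1" "j - 1"] unfolding rat_point_def by simp

lemma rat_point_surj: "x \<in> \<rat> \<Longrightarrow> \<exists>i. i \<noteq> 0 \<and> rat_point i = x"
proof -
  assume "x \<in> \<rat>"
  then obtain n where "from_nat_into \<rat> n = x" using rat_enum by (metis bij_betw_imp_surj_on imageE)
  then show ?thesis by (intro exI[of _ "Suc n"]) (simp add: rat_point_def)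
qed

lemma rat_cut_dense: "x < y \<Longrightarrow> \<exists>j. x < rat_cut j \<and> rat_cut j < y"
proof -
  let ?t = "SOME t :: real. t \<notin> \<rat>"
  assume "x < y"
  then obtain r where r: "r \<in> \<rat>" "x - ?t < r" "r < y - ?t"
    using Rats_dense_in_real[of "x - ?t" "y - ?t"] by auto
  obtain n where "from_nat_into \<rat> n = r" using rat_enum r(1) by (metis bij_betw_imp_surj_on imageE)
  with r show ?thesis by (intro exI[of _ n]) (simp add: rat_cut_def)
qed

interpretation rat: cantor_points rat_code
proof
  have less: "rat_code i \<noteq> rat_code j" if ij: "i \<noteq> 0" "j \<noteq> 0" "rat_point i < rat_point j" for i j
  proof -
    obtain k where "rat_point i < rat_cut k" "rat_cut k < rat_point j" using rat_cut_dense[OF ij(3)] by blast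
    then have "rat_code i k \<noteq> rat_code j k" using ij by (simp add: rat_code_def)
    then show ?thesis by auto
  qed
  have zero: "rat_code 0 \<noteq> rat_code j" if "j \<noteq> 0" for j
  proof -
    obtain k where "rat_point j < rat_cut k" using rat_cut_dense[of "rat_point j" "rat_point j + 1"] by auto
    then have "rat_code 0 k \<noteq> rat_code j k" using that by (simp add: rat_code_def)
    then show ?thesis by auto
  qed
  show "inj rat_code"
  proof (rule injI)
    fix i j assume eq: "rat_code i = rat_code j"
    consider "i = 0" | "j = 0" | "i \<noteq> 0" "j \<noteq> 0" by blast
    then show "i = j"
    proof cases
      case 3
      with eq less[of i j] less[of j i] have "rat_point i = rat_point j" by (metis linorder_neqE)
      with 3 show ?thesis by (metis rat_point_inj)
    qed (use eq zero[of i] zero[of j] in auto)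
  qed
qed

text \<open>Finitely many bits of a rational amount to strict inequalities with irrational cuts, an
  open condition. Together with \<open>rat_nbhd_agree\<close>, agreement of codes induces the usual
  topology on the rationals.\<close>

lemma rat_agree_nbhd:
  "\<exists>T. open T \<and> rat_point i \<in> T \<and>
     (\<forall>w. w \<noteq> 0 \<longrightarrow> i \<noteq> 0 \<longrightarrow> rat_point w \<in> T \<longrightarrow> rat.agree n i w)"
proof (intro exI conjI allI impI)
  let ?T = "\<Inter>j\<in>{..<n}. if rat_cut j < rat_point i then {rat_cut j<..} else {..<rat_cut j}"
  show "open ?T" by (intro open_INT) auto
  show "rat_point i \<in> ?T"
    using rat_cut_irrational rat_point_Rats[of i] by (auto simp: not_less order_less_le) metis+
  fix w assume "w \<noteq> 0" "i \<noteq> 0" "rat_point w \<in> ?T"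
  then show "rat.agree n i w"
    unfolding rat.agree_def rat_code_def
  proof (intro allI impI)
    fix j assume "j < n"
    with \<open>rat_point w \<in> ?T\<close>
    have "rat_point w \<in> (if rat_cut j < rat_point i then {rat_cut j<..} else {..<rat_cut j})" by blast
    with \<open>w \<noteq> 0\<close> \<open>i \<noteq> 0\<close> show "(i = 0 \<or> rat_cut j < rat_point i) = (w = 0 \<or> rat_cut j < rat_point w)"
      by (auto split: if_splits)
  qed
qed

text \<open>Two cuts \<open>a\<close> and \<open>b\<close> on either side of the point confine
  \<open>w\<close> to the ball. The bit at \<open>b\<close> is false for \<open>i\<close>, whereas
  all bits of \<open>0\<close> are true; this excludes infinity.\<close>

lemma rat_nbhd_agree:
  assumes "i \<noteq> 0" "open T" "rat_point i \<in> T"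
  shows "\<exists>n. \<forall>w. rat.agree n i w \<longrightarrow> w \<noteq> 0 \<and> rat_point w \<in> T"
proof -
  let ?x = "rat_point i"
  obtain e where e: "e > 0" "ball ?x e \<subseteq> T" using assms(2,3) open_contains_ball by blast
  obtain a where a: "?x - e < rat_cut a" "rat_cut a < ?x" using rat_cut_dense[of "?x - e" ?x] e by auto
  obtain b where b: "?x < rat_cut b" "rat_cut b < ?x + e" using rat_cut_dense[of ?x "?x + e"] e by auto
  have "w \<noteq> 0 \<and> rat_point w \<in> T" if "rat.agree (Suc (max a b)) i w" for w
  proof -
    have *: "rat_code w a = rat_code i a" "rat_code w b = rat_code i b"
      using that by (auto simp: rat.agree_def)
    then have "w \<noteq> 0" "rat_cut a < rat_point w" "rat_point w \<le> rat_cut b"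
      using a b assms(1) by (auto simp: rat_code_def)
    then have "rat_point w \<in> ball ?x e" using a b by (auto simp: dist_real_def)
    with e \<open>w \<noteq> 0\<close> show ?thesis by blast
  qed
  then show ?thesis by blast
qed

lemma rat_crowd_UNIV: "rat.crowd UNIV"
  unfolding rat.crowd_def
proof (intro ballI allI)
  fix i n
  show "\<exists>w\<in>UNIV. w \<noteq> i \<and> rat.agree n i w"
  proof (cases "i = 0")
    case True
    obtain w where w: "w \<noteq> 0" "rat_point w = of_nat (nat \<lceil>\<Sum>j<n. \<bar>rat_cut j\<bar>\<rceil> + 1)"
      using rat_point_surj[OF Rats_of_nat] by blast
    have "rat_cut j < rat_point w" if "j < n" for j
    proof -
      have "rat_cut j \<le> (\<Sum>j<n. \<bar>rat_cut j\<bar>)"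
        using member_le_sum[of j "{..<n}" "\<lambda>j. \<bar>rat_cut j\<bar>"] that by auto
      also have "\<dots> < rat_point w" unfolding w(2) by linarith
      finally show ?thesis .
    qed
    with w True show ?thesis by (auto simp: rat.agree_def rat_code_def)
  next
    case False
    obtain T where T: "open T" "rat_point i \<in> T" "\<And>w. w \<noteq> 0 \<Longrightarrow> rat_point w \<in> T \<Longrightarrow> rat.agree n i w"
      using rat_agree_nbhd[of i n] False by blast
    obtain e where e: "e > 0" "ball (rat_point i) e \<subseteq> T" using T(1,2) open_contains_ball by blast
    obtain r where r: "r \<in> \<rat>" "rat_point i < r" "r < rat_point i + e"
      using Rats_dense_in_real[of "rat_point i" "rat_point i + e"] e by auto
    then obtain w where w: "w \<noteq> 0" "rat_point w = r" using rat_point_surj by blast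
    have "r \<in> T" using r e(2) by (auto simp: dist_real_def)
    with T(3) w r(2) show ?thesis by (intro bexI[of _ w]) auto
  qed
qed

section \<open>Perfect sets of rationals and the generated ultrafilter\<close>

lemma perfect_rat_points:
  assumes C: "rat.crowd C" "0 \<in> C" and cl: "\<And>z. z \<notin> C \<Longrightarrow> \<exists>n. \<forall>w\<in>C. \<not> rat.agree n z w"
  shows "perfect_rat (rat_point ` (C - {0}))" (is "perfect_rat ?P")
  unfolding perfect_rat_def
proof (intro conjI)
  have "openin (top_of_set \<rat>) (\<rat> - ?P)"
  proof (subst openin_subopen, intro ballI)
    fix x assume x: "x \<in> \<rat> - ?P"
    then obtain z where z: "z \<noteq> 0" "rat_point z = x" using rat_point_surj by blast
    with x have "z \<notin> C" by auto
    with cl obtain n where n: "\<And>w. w \<in> C \<Longrightarrow> \<not> rat.agree n z w" by blast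
    obtain T where T: "open T" "x \<in> T" "\<And>w. w \<noteq> 0 \<Longrightarrow> rat_point w \<in> T \<Longrightarrow> rat.agree n z w"
      using rat_agree_nbhd[of z n] z by blast
    have "openin (top_of_set \<rat>) (\<rat> \<inter> T)" using T(1) by (rule openin_open_Int)
    moreover have "\<rat> \<inter> T \<subseteq> \<rat> - ?P" using T(3) n by auto
    ultimately show "\<exists>T. openin (top_of_set \<rat>) T \<and> x \<in> T \<and> T \<subseteq> \<rat> - ?P" using x T(2) by blast
  qed
  then show "closedin (top_of_set \<rat>) ?P" using rat_point_Rats by (auto simp: closedin_def)
  show "?P \<noteq> {}" using C unfolding rat.crowd_def by fastforce
  show "crowded ?P" unfolding crowded_def isolated_in_def
  proof
    assume "\<exists>x. x \<in> ?P \<and> (\<exists>T. open T \<and> T \<inter> ?P = {x})"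
    then obtain i T where i: "i \<in> C" "i \<noteq> 0" "open T" "T \<inter> ?P = {rat_point i}" by blast
    then have "rat_point i \<in> T" by blast
    with rat_nbhd_agree i(2,3) obtain n where n: "\<And>w. rat.agree n i w \<Longrightarrow> w \<noteq> 0 \<and> rat_point w \<in> T"
      by meson
    obtain w where w: "w \<in> C" "w \<noteq> i" "rat.agree n i w" using C(1) i(1) unfolding rat.crowd_def by blast
    then have "rat_point w \<in> T \<inter> ?P" using n by blast
    then have "rat_point w = rat_point i" using i(4) by blast
    then show False using rat_point_inj n[OF w(3)] i(2) w(2) by blast
  qed
qed

text \<open>The base consists of the perfect kernels \<open>P G\<close> with infinity removed. Their
  finite intersections are infinite, because a crowded set through \<open>0\<close> inside all the
  \<open>G\<close> lies in all their kernels, and \<open>decide\<close> settles each set of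
  rationals.\<close>

lemma gruff_from_family:
  assumes fir: "rat.fir \<G>"
    and thin: "\<And>G. G \<in> \<G> \<Longrightarrow> \<exists>h c. strict_mono h \<and> G = rat.thin h (coded c)"
    and decide: "\<And>A. \<exists>G\<in>\<G>. G \<subseteq> insert 0 A \<or> G \<subseteq> insert 0 (- A)"
  shows "\<exists>U. gruff_ultrafilter U"
proof -
  define P where "P G = rat_point ` (rat.kernel G - {0})" for G
  define U where "U = {A. A \<subseteq> \<rat> \<and> (\<exists>G\<in>\<G>. P G \<subseteq> A)}"
  have zero: "0 \<in> G" if "G \<in> \<G>" for G
    using thin[OF that] rat.zero_in_thin by auto
  have meet: "infinite (\<Inter>G\<in>F. P G)" if F: "finite F" "F \<noteq> {}" "F \<subseteq> \<G>" for F
  proof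
    have "rat.rich (\<Inter>F)" using fir F unfolding rat.fir_def by blast
    then obtain C where C: "rat.crowd C" "0 \<in> C" "C \<subseteq> insert 0 (\<Inter>F)" unfolding rat.rich_def by blast
    have "C \<subseteq> rat.kernel G" if "G \<in> F" for G
      using C zero that F(3) by (intro rat.kernel_greatest) auto
    then have "rat_point ` (C - {0}) \<subseteq> (\<Inter>G\<in>F. P G)" unfolding P_def by blast
    moreover assume "finite (\<Inter>G\<in>F. P G)"
    ultimately have "finite (rat_point ` (C - {0}))" by (rule finite_subset)
    then have "finite (C - {0})"
      by (rule finite_imageD) (use rat_point_inj in \<open>auto intro!: inj_onI\<close>)
    moreover have "rat.rich C" using C unfolding rat.rich_def by blast
    ultimately show False using rat.not_rich_finite by auto
  qed
  have dich: "A \<in> U \<or> \<rat> - A \<in> U" if "A \<subseteq> \<rat>" for A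
  proof -
    from decide[of "{i. rat_point i \<in> A}"] obtain G where G: "G \<in> \<G>"
      "G \<subseteq> insert 0 {i. rat_point i \<in> A} \<or> G \<subseteq> insert 0 (- {i. rat_point i \<in> A})" ..
    from G(2) have "P G \<subseteq> A \<or> P G \<subseteq> \<rat> - A"
    proof (elim disj_forward)
      assume "G \<subseteq> insert 0 {i. rat_point i \<in> A}"
      then show "P G \<subseteq> A" using rat.kernel_subset[of G] by (auto simp: P_def)
    next
      assume "G \<subseteq> insert 0 (- {i. rat_point i \<in> A})"
      then show "P G \<subseteq> \<rat> - A" using rat.kernel_subset[of G] rat_point_Rats by (auto simp: P_def)
    qed
    with G(1) that show ?thesis unfolding U_def by blast
  qed
  have inf: "infinite A" if "A \<in> U" for A
  proof -
    from that obtain G where "G \<in> \<G>" "P G \<subseteq> A" unfolding U_def by blast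
    with meet[of "{G}"] show ?thesis using finite_subset by auto
  qed
  \<comment> \<open>The family \<open>\<G>\<close> need not be closed under intersections. If
    \<open>A \<inter> B\<close> were not in \<open>U\<close>, its complement would be, and three
    sets \<open>P G\<close>, \<open>P H\<close>, \<open>P K\<close> would have empty
    intersection.\<close>
  have int: "A \<inter> B \<in> U" if AB: "A \<in> U" "B \<in> U" for A B
  proof (rule ccontr)
    assume "A \<inter> B \<notin> U"
    moreover have "A \<inter> B \<subseteq> \<rat>" using AB unfolding U_def by blast
    ultimately have "\<rat> - A \<inter> B \<in> U" using dich by blast
    with AB obtain G H K where "G \<in> \<G>" "P G \<subseteq> A" "H \<in> \<G>" "P H \<subseteq> B" "K \<in> \<G>" "P K \<subseteq> \<rat> - A \<inter> B"
      unfolding U_def by blast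
    with meet[of "{G, H, K}"] have "infinite (P G \<inter> P H \<inter> P K)" "P G \<inter> P H \<inter> P K = {}"
      by (auto simp: Int_assoc)
    then show False by simp
  qed
  have "ultrafilter_on \<rat> U" unfolding ultrafilter_on_def
  proof (intro conjI ballI allI impI)
    show "U \<subseteq> Pow \<rat>" unfolding U_def by blast
    show "\<rat> \<in> U" using dich[of "\<rat>"] inf[of "{}"] by auto
    show "{} \<notin> U" using inf by blast
    show "A \<inter> B \<in> U" if "A \<in> U" "B \<in> U" for A B using int that .
    show "B \<in> U" if "A \<in> U" "A \<subseteq> B \<and> B \<subseteq> \<rat>" for A B using that unfolding U_def by blast
    show "A \<in> U \<or> \<rat> - A \<in> U" if "A \<subseteq> \<rat>" for A using dich that .
  qed
  moreover have "\<not> principal_on \<rat> U"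
    using inf unfolding principal_on_def by (metis (mono_tags, lifting) finite.emptyI finite_insert
        insertI1 mem_Collect_eq empty_subsetI insert_subset)
  moreover have "\<exists>Q\<in>U. Q \<subseteq> A \<and> perfect_rat Q" if A: "A \<in> U" for A
  proof -
    obtain G where G: "G \<in> \<G>" "P G \<subseteq> A" using A unfolding U_def by blast
    obtain h c where h: "strict_mono h" "G = rat.thin h (coded c)" using thin[OF G(1)] by blast
    have "rat.rich (\<Inter>{G})" using fir G(1) unfolding rat.fir_def by blast
    then have "0 \<in> rat.kernel G"
      using zero[OF G(1)] by (simp add: rat.rich_iff_kernel insert_absorb)
    moreover have "\<exists>n. \<forall>w\<in>rat.kernel G. \<not> rat.agree n z w" if "z \<notin> rat.kernel G" for z
      using that rat.thin_closed[OF h(1)] unfolding h(2) by (rule rat.kernel_closed[rotated])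
    ultimately have "perfect_rat (P G)"
      unfolding P_def by (intro perfect_rat_points rat.crowd_kernel)
    moreover have "P G \<in> U" using G(1) rat_point_Rats unfolding U_def P_def by blast
    ultimately show ?thesis using G(2) by blast
  qed
  ultimately show ?thesis unfolding gruff_ultrafilter_def by blast
qed

section \<open>Countable ordinals and closed unbounded sets\<close>

lemma elts_set_of:
  assumes "is_H \<kappa> E" "elts E x = A" shows "elts E (set_of E A) = A"
proof -
  have "set_of E A = x" unfolding set_of_def
    by (rule the_equality) (use assms in \<open>auto simp: is_H_def\<close>)
  then show ?thesis using assms by simp
qed

text \<open>A transitive set is its own transitive closure, and a countable one is at most as large
  as the reals, hence smaller than \<open>\<kappa>\<close>.\<close>

lemma elts_set_of_countable:
  assumes \<kappa>: "|UNIV :: real set| <o \<kappa>" and H: "is_H \<kappa> E"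
    and A: "countable A" "\<And>a. a \<in> A \<Longrightarrow> elts E a \<subseteq> A"
  shows "elts E (set_of E A) = A"
proof -
  have "y \<in> A" if "(y, x) \<in> E\<^sup>*" "x \<in> A" for x y
    using that by (induction rule: converse_rtrancl_induct) (use A(2) in \<open>auto simp: elts_def\<close>)
  then have tr: "trcl_set E A = A" by (auto simp: trcl_set_def)
  obtain f :: "_ \<Rightarrow> nat" where "inj_on f A" using A(1) by (rule countableE)
  then have "inj_on (\<lambda>x. real (f x)) A" by (auto simp: inj_on_def)
  then have "|A| \<le>o |UNIV :: real set|" using card_of_ordLeq by blast
  then have "|trcl_set E A| <o \<kappa>" unfolding tr using \<kappa> by (rule ordLeq_ordLess_trans)
  then obtain x where "elts E x = A" using H unfolding is_H_def by blast
  with H show ?thesis by (rule elts_set_of)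
qed

lemma mem_elts: "y \<in> elts E x \<longleftrightarrow> (y, x) \<in> E"
  by (simp add: elts_def)

lemma wf_no_cycles:
  assumes "wf E"
  shows "(x, x) \<notin> E" "(x, y) \<in> E \<Longrightarrow> (y, x) \<notin> E"
    "(x, y) \<in> E \<Longrightarrow> (y, z) \<in> E \<Longrightarrow> (z, x) \<notin> E"
proof -
  have "acyclic E" using assms by (rule wf_acyclic)
  then have *: "(u, u) \<notin> E\<^sup>+" for u by (simp add: acyclic_def)
  show "(x, x) \<notin> E" "(x, y) \<in> E \<Longrightarrow> (y, x) \<notin> E"
    "(x, y) \<in> E \<Longrightarrow> (y, z) \<in> E \<Longrightarrow> (z, x) \<notin> E"
    using *[of x] by (meson r_into_trancl trancl_into_trancl)+
qed

lemma omega1_trans: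
  assumes "\<alpha> \<in> omega1 E" "(\<gamma>, \<beta>) \<in> E" "(\<beta>, \<alpha>) \<in> E" shows "(\<gamma>, \<alpha>) \<in> E"
  using assms by (auto simp: omega1_def is_ordinal_def elts_def)

lemma omega1_downward:
  assumes wf: "wf E" and \<alpha>: "\<alpha> \<in> omega1 E" and \<beta>: "(\<beta>, \<alpha>) \<in> E" shows "\<beta> \<in> omega1 E"
proof -
  have tr: "(z, \<alpha>) \<in> E" if "(z, y) \<in> E" "(y, \<alpha>) \<in> E" for y z using omega1_trans[OF \<alpha>] that .
  have lin: "(y, z) \<in> E \<or> y = z \<or> (z, y) \<in> E" if "(y, \<alpha>) \<in> E" "(z, \<alpha>) \<in> E" for y z
    using \<alpha> that by (auto simp: omega1_def is_ordinal_def elts_def)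
  have "(z, \<beta>) \<in> E" if "(z, y) \<in> E" "(y, \<beta>) \<in> E" for y z
    using lin[of z \<beta>] tr that \<beta> wf_no_cycles[OF wf] by blast
  then have "is_ordinal E \<beta>" using lin tr \<beta> by (auto simp: is_ordinal_def elts_def)
  moreover have "elts E \<beta> \<subseteq> elts E \<alpha>" using tr \<beta> by (auto simp: elts_def)
  then have "countable (elts E \<beta>)" using \<alpha> countable_subset by (auto simp: omega1_def)
  ultimately show ?thesis by (simp add: omega1_def)
qed

text \<open>An \<open>E\<close>-minimal element \<open>d\<close> of \<open>\<alpha>\<close> outside
  \<open>\<gamma>\<close> has exactly the elements of \<open>\<gamma>\<close>, so
  \<open>d = \<gamma>\<close> by extensionality.\<close>

lemma omega1_initial_segment:
  assumes H: "is_H \<kappa> E" and \<alpha>: "\<alpha> \<in> omega1 E" and sub: "elts E \<gamma> \<subseteq> elts E \<alpha>"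
    and tr: "\<And>x y. (x, \<gamma>) \<in> E \<Longrightarrow> (y, x) \<in> E \<Longrightarrow> (y, \<gamma>) \<in> E"
  shows "(\<gamma>, \<alpha>) \<in> E\<^sup>="
proof (cases "elts E \<gamma> = elts E \<alpha>")
  case True then show ?thesis using H by (auto simp: is_H_def)
next
  case False
  have wf: "wf E" using H by (simp add: is_H_def)
  from False sub obtain d where d: "d \<in> elts E \<alpha> - elts E \<gamma>"
    "\<And>y. (y, d) \<in> E \<Longrightarrow> y \<notin> elts E \<alpha> - elts E \<gamma>"
    using wfE_min[OF wf, of _ "elts E \<alpha> - elts E \<gamma>"] by blast
  have "elts E d = elts E \<gamma>"
  proof (intro equalityI subsetI)
    fix y assume "y \<in> elts E d"
    then show "y \<in> elts E \<gamma>" using d omega1_trans[OF \<alpha>, of y d] by (auto simp: mem_elts)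
  next
    fix y assume y: "y \<in> elts E \<gamma>"
    then have "(y, d) \<in> E \<or> y = d \<or> (d, y) \<in> E"
      using \<alpha> sub d(1) unfolding omega1_def is_ordinal_def by blast
    then show "y \<in> elts E d" using y d(1) tr[of y d] by (auto simp: mem_elts)
  qed
  then have "d = \<gamma>" using H by (auto simp: is_H_def)
  with d(1) show ?thesis by (simp add: mem_elts)
qed

text \<open>The intersection of the two ordinals is an initial segment of each; were it an element
  of both, it would be an element of itself.\<close>

lemma omega1_linear:
  assumes \<kappa>: "|UNIV :: real set| <o \<kappa>" and H: "is_H \<kappa> E"
    and \<alpha>: "\<alpha> \<in> omega1 E" and \<beta>: "\<beta> \<in> omega1 E"
  shows "(\<alpha>, \<beta>) \<in> E\<^sup>= \<or> (\<beta>, \<alpha>) \<in> E\<^sup>="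
proof -
  have wf: "wf E" using H by (simp add: is_H_def)
  define \<gamma> where "\<gamma> = set_of E (elts E \<alpha> \<inter> elts E \<beta>)"
  have \<gamma>: "elts E \<gamma> = elts E \<alpha> \<inter> elts E \<beta>" unfolding \<gamma>_def
  proof (rule elts_set_of_countable[OF \<kappa> H])
    show "countable (elts E \<alpha> \<inter> elts E \<beta>)" using \<alpha> by (simp add: omega1_def)
    show "elts E a \<subseteq> elts E \<alpha> \<inter> elts E \<beta>" if "a \<in> elts E \<alpha> \<inter> elts E \<beta>" for a
      using that omega1_trans[OF \<alpha>] omega1_trans[OF \<beta>] by (auto simp: mem_elts)
  qed
  have tr: "(y, \<gamma>) \<in> E" if "(x, \<gamma>) \<in> E" "(y, x) \<in> E" for x y
    using that \<gamma> omega1_trans[OF \<alpha>] omega1_trans[OF \<beta>] by (auto simp: set_eq_iff mem_elts)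
  have "(\<gamma>, \<alpha>) \<in> E\<^sup>=" by (rule omega1_initial_segment[OF H \<alpha> _ tr]) (use \<gamma> in blast)+
  moreover have "(\<gamma>, \<beta>) \<in> E\<^sup>=" by (rule omega1_initial_segment[OF H \<beta> _ tr]) (use \<gamma> in blast)+
  moreover have "\<not> ((\<gamma>, \<alpha>) \<in> E \<and> (\<gamma>, \<beta>) \<in> E)"
    using \<gamma> wf_no_cycles(1)[OF wf, of \<gamma>] by (auto simp: set_eq_iff mem_elts)
  ultimately show ?thesis by auto
qed

text \<open>Closure under elements of countable members makes \<open>M \<inter> omega1 E\<close>
  transitive, and \<open>omega1_linear\<close> makes it linearly ordered.\<close>

lemma height_omega1:
  assumes \<kappa>: "|UNIV :: real set| <o \<kappa>" and H: "is_H \<kappa> E" and "countable M"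
    and M: "\<And>x y. x \<in> M \<Longrightarrow> countable (elts E x) \<Longrightarrow> (y, x) \<in> E \<Longrightarrow> y \<in> M"
  shows "elts E (height E M) = M \<inter> omega1 E" "height E M \<in> omega1 E"
proof -
  have wf: "wf E" using H by (simp add: is_H_def)
  have tr: "elts E a \<subseteq> M \<inter> omega1 E" if "a \<in> M \<inter> omega1 E" for a
    using that M[of a] omega1_downward[OF wf, of a] by (auto simp: mem_elts omega1_def)
  show el: "elts E (height E M) = M \<inter> omega1 E"
    unfolding height_def by (rule elts_set_of_countable[OF \<kappa> H]) (use \<open>countable M\<close> tr in auto)
  show "height E M \<in> omega1 E"
  proof -
    have "(y, z) \<in> E \<or> y = z \<or> (z, y) \<in> E" if "y \<in> omega1 E" "z \<in> omega1 E" for y z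
      using omega1_linear[OF \<kappa> H that] by blast
    then have "is_ordinal E (height E M)" unfolding is_ordinal_def el using tr by blast
    then show ?thesis unfolding omega1_def using el \<open>countable M\<close> by simp
  qed
qed

section \<open>Countable sets closed under countably many operations\<close>

lemma finite_subset_incseq_UN:
  assumes "incseq Y" "finite F" "F \<subseteq> (\<Union>n. Y n)" shows "\<exists>n. F \<subseteq> Y n"
  using assms(2,3)
proof (induction F)
  case (insert a F)
  then obtain m n where "F \<subseteq> Y m" "a \<in> Y n" by auto
  moreover have "Y m \<subseteq> Y (max m n)" "Y n \<subseteq> Y (max m n)" using assms(1) by (auto simp: incseq_def)
  ultimately show ?case by blast
qed simp

text \<open>A countable set is closed off in \<omega> steps. Each finite list from an increasing
  union already lies in one stage, which gives both unboundedness and closure.\<close>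

lemma club_closed_sets:
  fixes F :: "'i::countable \<Rightarrow> 'h list \<Rightarrow> 'h"
  shows "club_in UNIV {A. countable A \<and> infinite A \<and> (\<forall>i xs. set xs \<subseteq> A \<longrightarrow> F i xs \<in> A)}"
    (is "club_in UNIV ?C")
  unfolding club_in_def
proof (intro conjI ballI allI impI)
  show "?C \<subseteq> ctbl_subsets UNIV" by (auto simp: ctbl_subsets_def)
next
  fix A :: "'h set" assume A: "A \<in> ctbl_subsets UNIV"
  define Y where "Y = rec_nat A (\<lambda>_ B. B \<union> (\<Union>i. F i ` lists B))"
  have Y: "Y 0 = A" "Y (Suc n) = Y n \<union> (\<Union>i. F i ` lists (Y n))" for n by (simp_all add: Y_def)
  have "incseq Y" by (rule incseq_SucI) (auto simp: Y)
  have ct: "countable (Y n)" for n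
    by (induction n) (use A in \<open>auto simp: Y ctbl_subsets_def intro!: countable_lists\<close>)
  have "F i xs \<in> (\<Union>n. Y n)" if xs: "set xs \<subseteq> (\<Union>n. Y n)" for i xs
  proof -
    obtain n where "set xs \<subseteq> Y n"
      using finite_subset_incseq_UN[OF \<open>incseq Y\<close> _ xs] by blast
    then have "F i xs \<in> Y (Suc n)" unfolding Y by auto
    then show ?thesis by blast
  qed
  moreover have "A \<subseteq> (\<Union>n. Y n)" using Y(1) by blast
  moreover from this have "infinite (\<Union>n. Y n)" using A infinite_super by (auto simp: ctbl_subsets_def)
  ultimately show "\<exists>B\<in>?C. A \<subseteq> B" using ct by (intro bexI[of _ "\<Union>n. Y n"]) auto
next
  fix Y :: "nat \<Rightarrow> 'h set" assume Y: "incseq Y \<and> range Y \<subseteq> ?C"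
  have "F i xs \<in> (\<Union>n. Y n)" if xs: "set xs \<subseteq> (\<Union>n. Y n)" for i xs
  proof -
    obtain n where "set xs \<subseteq> Y n"
      using finite_subset_incseq_UN[OF _ _ xs] Y by blast
    then have "F i xs \<in> Y n" using Y by blast
    then show ?thesis by blast
  qed
  moreover have "infinite (Y 0)" using Y by blast
  then have "infinite (\<Union>n. Y n)" by (rule infinite_super[rotated]) blast
  moreover have "countable (Y n)" for n using Y by blast
  then have "countable (\<Union>n. Y n)" by simp
  ultimately show "(\<Union>n. Y n) \<in> ?C" by simp
qed

lemma stationary_closed_set:
  fixes F :: "'i::countable \<Rightarrow> 'h list \<Rightarrow> 'h"
  assumes "stationary_in UNIV S"
  shows "\<exists>M\<in>S. \<forall>i xs. set xs \<subseteq> M \<longrightarrow> F i xs \<in> M"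
  using assms club_closed_sets[of F] unfolding stationary_in_def by blast

section \<open>The recursion along the heights\<close>

text \<open>Stated for a total preorder, since different pairs may share a height. The new element
  \<open>a\<close> is placed between the elements below it and the rest.\<close>

lemma sorted_list_of_total:
  assumes "finite A"
    and total: "\<And>a b. a \<in> A \<Longrightarrow> b \<in> A \<Longrightarrow> le a b \<or> le b a"
    and trans: "\<And>a b c. a \<in> A \<Longrightarrow> b \<in> A \<Longrightarrow> c \<in> A \<Longrightarrow> le a b \<Longrightarrow> le b c \<Longrightarrow> le a c"
  shows "\<exists>xs. set xs = A \<and> sorted_wrt le xs"
  using assms
proof (induction A)
  case empty
  show ?case by (rule exI[of _ "[]"]) simp
next
  case (insert a A)
  have "\<exists>xs. set xs = A \<and> sorted_wrt le xs"
    by (rule insert.IH) (meson insert.prems insertI2)+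
  then obtain xs where xs: "set xs = A" "sorted_wrt le xs" by blast
  let ?ys = "filter (\<lambda>b. le b a) xs @ a # filter (\<lambda>b. \<not> le b a) xs"
  have "le b c" if b: "b \<in> A" "le b a" and c: "c \<in> A" "\<not> le c a" for b c
  proof -
    have "le a c" using insert.prems(1)[of a c] c by auto
    then show ?thesis using insert.prems(2)[of b a c] b c by simp
  qed
  moreover have "le a c" if c: "c \<in> A" "\<not> le c a" for c
    using insert.prems(1)[of a c] c by auto
  ultimately have "sorted_wrt le ?ys"
    using xs by (auto simp: sorted_wrt_append sorted_wrt_filter)
  moreover have "set ?ys = insert a A" using xs by auto
  ultimately show ?case by blast
qed

text \<open>
  The properties of the models that the construction uses; they hold after shrinking \<open>\<S>\<close> to
  the models closed under countably many functions, so that no definability is needed.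
\<close>

locale thinning_pathway = cantor_points +
  fixes E :: "'h rel" and \<B> :: "'h \<Rightarrow> nat \<Rightarrow> nat" and \<S> :: "'h set set"
  assumes rich_UNIV: "rich UNIV"
    and wf_E: "wf E"
    and height_linear: "M \<in> \<S> \<Longrightarrow> N \<in> \<S> \<Longrightarrow>
      (height E M, height E N) \<in> E\<^sup>= \<or> (height E N, height E M) \<in> E\<^sup>="
    and height_trans: "M \<in> \<S> \<Longrightarrow> (\<gamma>, \<delta>) \<in> E \<Longrightarrow> (\<delta>, height E M) \<in> E \<Longrightarrow> (\<gamma>, height E M) \<in> E"
    and below_height: "M \<in> \<S> \<Longrightarrow> (\<gamma>, height E M) \<in> E \<Longrightarrow> \<gamma> \<in> M"
    and mono_\<B>: "M \<in> \<S> \<Longrightarrow> strict_mono (\<B> (height E M))"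
    and rel_mem: "M \<in> \<S> \<Longrightarrow> set gs \<subseteq> M \<Longrightarrow> rel_code E (n + 2) (thinning_rel n (map \<B> gs)) \<in> M"
    and pathway: "\<And>n M R x. (\<And>i. i \<le> n \<Longrightarrow> M i \<in> \<S>) \<Longrightarrow> delta_increasing E n M \<Longrightarrow>
      projective (n + 2) R \<Longrightarrow> adequate (n + 1) R \<Longrightarrow> rel_code E (n + 2) R \<in> M n \<Longrightarrow>
      (\<And>i. i \<le> n \<Longrightarrow> baire_code E (x i) \<in> M i) \<Longrightarrow>
      tuple_snoc (n + 1) x (\<B> (height E (M n))) \<in> R"
    and covering: "\<exists>M\<in>\<S>. baire_code E x \<in> M \<and> baire_code E y \<in> M"
begin

text \<open>Models of equal height may differ, so the reals of a level need not lie in a common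
  model; this is why sequences of several models are used.\<close>

definition at_level :: "'h \<Rightarrow> (nat \<Rightarrow> nat) \<Rightarrow> bool" where
  "at_level \<gamma> x \<longleftrightarrow> (\<exists>M\<in>\<S>. height E M = \<gamma> \<and> baire_code E x \<in> M)"

text \<open>Reads \<open>w\<close> only at \<open>E\<close>-predecessors of \<open>\<delta>\<close>,
  as a recursion along \<open>E\<close> requires.\<close>

definition thinned_below :: "('h \<Rightarrow> nat set set) \<Rightarrow> 'h \<Rightarrow> nat set set" where
  "thinned_below w \<delta> =
     (\<lambda>(\<gamma>, x). thin (\<B> \<gamma>) (coded x)) ` {(\<gamma>, x). (\<gamma>, \<delta>) \<in> E \<and> at_level \<gamma> x \<and> coded x \<in> w \<gamma>}"

text \<open>Let \<open>\<delta>\<close> be the greatest height. Pairs of smaller height contribute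
  sets already thinned, those at \<open>\<delta>\<close> sets not yet thinned, and all of these lie
  in \<open>w \<delta>\<close>. So \<open>before\<close> is rich, and the pathway with
  \<open>\<B> \<delta>\<close> passes to \<open>after\<close>.\<close>

lemma rich_thinned:
  fixes w :: "'h \<Rightarrow> nat set set"
  assumes A: "finite A" "A \<noteq> {}" "\<And>\<gamma> x. (\<gamma>, x) \<in> A \<Longrightarrow> at_level \<gamma> x \<and> coded x \<in> w \<gamma>"
    and w: "\<And>\<gamma> x. (\<gamma>, x) \<in> A \<Longrightarrow> fir (w \<gamma>) \<and> thinned_below w \<gamma> \<subseteq> w \<gamma>"
  shows "rich (\<Inter>(\<gamma>, x)\<in>A. thin (\<B> \<gamma>) (coded x))"
proof -
  define le :: "'h \<times> (nat \<Rightarrow> nat) \<Rightarrow> 'h \<times> (nat \<Rightarrow> nat) \<Rightarrow> bool"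
    where "le p q \<longleftrightarrow> (fst p, fst q) \<in> E\<^sup>=" for p q
  have "\<exists>M. \<forall>p\<in>A. M p \<in> \<S> \<and> height E (M p) = fst p \<and> baire_code E (snd p) \<in> M p"
    using A(3) unfolding at_level_def by (intro bchoice) fastforce
  then obtain Mf where Mf: "\<And>p. p \<in> A \<Longrightarrow> Mf p \<in> \<S>" "\<And>p. p \<in> A \<Longrightarrow> height E (Mf p) = fst p"
    "\<And>p. p \<in> A \<Longrightarrow> baire_code E (snd p) \<in> Mf p" by blast
  have total: "le p q \<or> le q p" if "p \<in> A" "q \<in> A" for p q
    using height_linear[of "Mf p" "Mf q"] Mf(1,2) that by (simp add: le_def)
  have trans: "le p r" if "p \<in> A" "q \<in> A" "r \<in> A" "le p q" "le q r" for p q r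
    using height_trans[of "Mf r" "fst p" "fst q"] Mf(1,2)[of r] that by (auto simp: le_def)
  have "\<exists>us. set us = A \<and> sorted_wrt le us"
  proof (rule sorted_list_of_total[OF A(1)])
    show "le p q \<or> le q p" if "p \<in> A" "q \<in> A" for p q using that by (rule total)
    show "le p r" if "p \<in> A" "q \<in> A" "r \<in> A" "le p q" "le q r" for p q r using that by (rule trans)
  qed
  then obtain us where us: "set us = A" "sorted_wrt le us" by blast
  define \<delta> where "\<delta> = fst (last us)"
  have "us \<noteq> []" using us(1) A(2) by auto
  then have \<delta>: "last us \<in> A" using us(1) last_in_set by blast
  have top: "le p (last us)" if "p \<in> A" for p
  proof -
    have "us = butlast us @ [last us]" using \<open>us \<noteq> []\<close> by simp
    then have "p \<in> set (butlast us) \<or> p = last us" "sorted_wrt le (butlast us @ [last us])"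
      using that us by (metis set_append Un_iff empty_iff insert_iff list.set, metis)
    then show ?thesis using total[OF \<delta> \<delta>] by (auto simp: sorted_wrt_append)
  qed
  \<comment> \<open>The lower pairs go first, because \<open>before\<close> treats an initial
    segment of the coordinates as already thinned.\<close>
  define ys where "ys = filter (\<lambda>p. (fst p, \<delta>) \<in> E) us"
  define zs where "zs = filter (\<lambda>p. (fst p, \<delta>) \<notin> E) us"
  have zs\<delta>: "fst p = \<delta>" if "p \<in> set zs" for p
    using that top[of p] us(1) by (auto simp: zs_def le_def \<delta>_def)
  have irr: "(\<delta>, \<delta>) \<notin> E" using wf_E by simp
  have zs: "zs \<noteq> []"
  proof -
    have "last us \<in> set zs" using irr \<delta> us(1) by (simp add: zs_def \<delta>_def)
    then show ?thesis by auto
  qed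
  define xs where "xs = ys @ zs"
  have xs: "set xs = A" using us(1) by (auto simp: xs_def ys_def zs_def)
  have "sorted_wrt le ys" unfolding ys_def using us(2) by (rule sorted_wrt_filter)
  moreover have "sorted_wrt le zs"
    by (rule sorted_wrt_mono_rel[of _ "\<lambda>_ _. True"]) (auto simp: le_def zs\<delta>)
  ultimately have sorted: "sorted_wrt le xs"
    unfolding xs_def sorted_wrt_append using zs\<delta> by (auto simp: ys_def le_def)
  define n where "n = length xs - 1"
  have n: "Suc n = length xs" using zs by (simp add: n_def xs_def Suc_leI)
  define x where "x i = snd (xs ! i)" for i
  define gs where "gs = map fst ys"
  define M where "M i = Mf (xs ! i)" for i
  have inA: "xs ! i \<in> A" if "i \<le> n" for i using xs n that nth_mem[of i xs] by auto
  have low: "xs ! i = ys ! i" "i < length gs \<Longrightarrow> gs ! i = fst (xs ! i)" if "i < length ys" for i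
    using that by (simp_all add: xs_def gs_def nth_append)
  have high: "fst (xs ! i) = \<delta>" if "i \<le> n" "\<not> i < length ys" for i
  proof -
    have "xs ! i = zs ! (i - length ys)" "i - length ys < length zs"
      using that n by (auto simp: xs_def nth_append)
    then show ?thesis using zs\<delta> by simp
  qed
  have len: "length ys \<le> n" using n zs by (cases zs) (simp_all add: xs_def)
  have hM: "height E (M i) = fst (xs ! i)" if "i \<le> n" for i
    using Mf(2) inA[OF that] by (simp add: M_def)
  have Mn: "height E (M n) = \<delta>" using hM[of n] high[of n] len by simp
  define v where "v = tuple_snoc (n + 1) x (\<B> \<delta>)"
  have snoc: "v i = x i" if "i \<le> n" for i
    using that by (simp add: v_def tuple_snoc_def)
  have snoc': "v (Suc n) = \<B> \<delta>" by (simp add: v_def tuple_snoc_def)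
  have "tuple_snoc (n + 1) x (\<B> (height E (M n))) \<in> thinning_rel n (map \<B> gs)"
  proof (rule pathway)
    show "M i \<in> \<S>" if "i \<le> n" for i using Mf(1) inA[OF that] by (simp add: M_def)
    show "delta_increasing E n M" unfolding delta_increasing_def
    proof (intro allI impI)
      fix i assume "i < n"
      then have "le (xs ! i) (xs ! Suc i)" using sorted_wrt_nth_less[OF sorted, of i "Suc i"] n by simp
      with \<open>i < n\<close> show "(height E (M i), height E (M (Suc i))) \<in> E\<^sup>=" by (simp add: hM le_def)
    qed
    show "projective (n + 2) (thinning_rel n (map \<B> gs))" by (rule projective_thinning_rel)
    show "adequate (n + 1) (thinning_rel n (map \<B> gs))" by (rule adequate_thinning_rel)
    have "M n \<in> \<S>" using Mf(1) inA[of n] by (simp add: M_def)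
    \<comment> \<open>Heights below that of \<open>M n\<close> are elements of \<open>M n\<close>,
      so they may serve as parameters of the relation.\<close>
    moreover have "set gs \<subseteq> M n"
      using below_height[OF \<open>M n \<in> \<S>\<close>] by (auto simp: gs_def ys_def Mn)
    ultimately show "rel_code E (n + 2) (thinning_rel n (map \<B> gs)) \<in> M n" by (rule rel_mem)
    show "baire_code E (x i) \<in> M i" if "i \<le> n" for i
      using Mf(3) inA[OF that] by (simp add: M_def x_def)
  qed
  then have imp: "rich (before n (map \<B> gs) v) \<Longrightarrow>
      rich (after n (map \<B> gs) v)"
    unfolding Mn v_def thinning_rel_def by blast
  have "(\<lambda>i. if i < length (map \<B> gs) then thin (map \<B> gs ! i) (coded (v i))
      else coded (v i)) ` {..n} \<subseteq> w \<delta>" (is "?S ` _ \<subseteq> _")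
  proof
    fix X assume "X \<in> ?S ` {..n}"
    then obtain i where i: "i \<le> n" "X = ?S i" by blast
    have p: "at_level (fst (xs ! i)) (x i)" "coded (x i) \<in> w (fst (xs ! i))"
      using A(3)[of "fst (xs ! i)" "x i"] inA[OF i(1)] by (simp_all add: x_def)
    show "X \<in> w \<delta>"
    proof (cases "i < length ys")
      case True
      then have "(fst (xs ! i), \<delta>) \<in> E" using nth_mem[OF True] low(1)[OF True] by (auto simp: ys_def)
      then have "thin (\<B> (fst (xs ! i))) (coded (x i)) \<in> thinned_below w \<delta>"
        using p unfolding thinned_below_def by (intro image_eqI[of _ _ "(fst (xs ! i), x i)"]) auto
      moreover have "X = thin (\<B> (fst (xs ! i))) (coded (x i))"
        using True low i by (simp add: gs_def snoc)
      ultimately show ?thesis using w[of \<delta> "snd (last us)"] \<delta> by (auto simp: \<delta>_def)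
    next
      case False
      then show ?thesis using p(2) high[OF i(1) False] i by (simp add: gs_def snoc)
    qed
  qed
  then have "rich (before n (map \<B> gs) v)"
    using w[of \<delta> "snd (last us)"] \<delta> unfolding before_def fir_def by (simp add: \<delta>_def)
  from imp[OF this] show ?thesis
  proof (rule rich_mono)
    show "after n (map \<B> gs) v \<subseteq> (\<Inter>(\<gamma>, x)\<in>A. thin (\<B> \<gamma>) (coded x))"
    proof (clarify)
      fix a \<gamma> y assume a: "a \<in> after n (map \<B> gs) v" and p: "(\<gamma>, y) \<in> A"
      then obtain i where i: "i \<le> n" "xs ! i = (\<gamma>, y)"
        using xs n by (metis in_set_conv_nth less_Suc_eq_le)
      have "a \<in> thin (if i < length (map \<B> gs) then map \<B> gs ! i else v (Suc n))
          (coded (v i))"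
        using a i(1) unfolding after_def by blast
      moreover have "\<gamma> = \<delta>" if "\<not> i < length ys" using high[OF i(1) that] i(2) by simp
      moreover have "gs ! i = \<gamma>" if "i < length ys" using low(2)[OF that] that i(2) by (simp add: gs_def)
      moreover have "x i = y" using i(2) by (simp add: x_def)
      ultimately show "a \<in> thin (\<B> \<gamma>) (coded y)"
        by (cases "i < length ys") (simp_all add: gs_def snoc[OF i(1)] snoc')
    qed
  qed
qed

text \<open>At stage \<open>\<delta>\<close>, \<open>rich_thinned\<close> shows that
  \<open>thinned_below w \<delta>\<close> has rich finite intersections, and
  \<open>fir_extend\<close> completes it. The recursion runs over all elements of the structure,
  whether or not they are heights of models.\<close>

lemma ultrafilter_choice:
  "\<exists>w. \<forall>\<delta>. fir (w \<delta>) \<and> thinned_below w \<delta> \<subseteq> w \<delta> \<and> (\<forall>A B. A \<union> B = UNIV \<longrightarrow> A \<in> w \<delta> \<or> B \<in> w \<delta>)"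
proof (rule dependent_wf_choice[OF wf_E, where P = "\<lambda>w \<delta> \<W>. fir \<W> \<and> thinned_below w \<delta> \<subseteq> \<W> \<and>
    (\<forall>A B. A \<union> B = UNIV \<longrightarrow> A \<in> \<W> \<or> B \<in> \<W>)"])
  fix v w :: "'h \<Rightarrow> nat set set" and \<delta> r
  assume "\<And>\<gamma>. (\<gamma>, \<delta>) \<in> E \<Longrightarrow> v \<gamma> = w \<gamma>"
  then have "thinned_below v \<delta> = thinned_below w \<delta>" unfolding thinned_below_def by (intro image_cong) auto
  then show "(fir r \<and> thinned_below v \<delta> \<subseteq> r \<and> (\<forall>A B. A \<union> B = UNIV \<longrightarrow> A \<in> r \<or> B \<in> r)) =
      (fir r \<and> thinned_below w \<delta> \<subseteq> r \<and> (\<forall>A B. A \<union> B = UNIV \<longrightarrow> A \<in> r \<or> B \<in> r))" by simp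
next
  fix \<delta> w
  assume IH: "\<And>\<gamma>. (\<gamma>, \<delta>) \<in> E \<Longrightarrow> fir (w \<gamma>) \<and> thinned_below w \<gamma> \<subseteq> w \<gamma> \<and>
    (\<forall>A B. A \<union> B = UNIV \<longrightarrow> A \<in> w \<gamma> \<or> B \<in> w \<gamma>)"
  have fir: "fir (thinned_below w \<delta>)" unfolding fir_def
  proof safe
    fix F assume F: "finite F" "F \<subseteq> thinned_below w \<delta>"
    then obtain A where A: "A \<subseteq> {(\<gamma>, x). (\<gamma>, \<delta>) \<in> E \<and> at_level \<gamma> x \<and> coded x \<in> w \<gamma>}" "finite A"
      "F = (\<lambda>(\<gamma>, x). thin (\<B> \<gamma>) (coded x)) ` A"
      unfolding thinned_below_def by (meson finite_subset_image)
    show "rich (\<Inter>F)"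
    proof (cases "A = {}")
      case True
      then show ?thesis using A(3) rich_UNIV by simp
    next
      case False
      have "rich (\<Inter>(\<gamma>, x)\<in>A. thin (\<B> \<gamma>) (coded x))"
        by (rule rich_thinned[OF A(2) False, of w]) (use A(1) IH in auto)
      then show ?thesis using A(3) by simp
    qed
  qed
  from fir_extend[OF fir] obtain \<W> where "thinned_below w \<delta> \<subseteq> \<W>" "fir \<W>"
    "\<forall>A B. A \<union> B = UNIV \<longrightarrow> A \<in> \<W> \<or> B \<in> \<W>" by (elim exE conjE)
  then show "\<exists>\<W>. fir \<W> \<and> thinned_below w \<delta> \<subseteq> \<W> \<and> (\<forall>A B. A \<union> B = UNIV \<longrightarrow> A \<in> \<W> \<or> B \<in> \<W>)"
    by (intro exI[of _ \<W>] conjI)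
qed

text \<open>Collects the thinned sets of all levels. To decide \<open>A\<close>, codes of
  \<open>A\<close> and of its complement, both with \<open>0\<close> added, are put into one model;
  the family at its height contains one of the two sets, and thinning stays inside it.\<close>

lemma thinned_family:
  obtains \<G> where "fir \<G>" "\<And>G. G \<in> \<G> \<Longrightarrow> \<exists>h c. strict_mono h \<and> G = thin h (coded c)"
    "\<And>A. \<exists>G\<in>\<G>. G \<subseteq> insert 0 A \<or> G \<subseteq> insert 0 (- A)"
proof -
  obtain w where w: "\<And>\<delta>. fir (w \<delta>)" "\<And>\<delta>. thinned_below w \<delta> \<subseteq> w \<delta>"
    "\<And>\<delta> A B. A \<union> B = UNIV \<Longrightarrow> A \<in> w \<delta> \<or> B \<in> w \<delta>"
    using ultrafilter_choice by metis
  define \<D> where "\<D> = {(\<gamma>, x). at_level \<gamma> x \<and> coded x \<in> w \<gamma>}"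
  define t where "t = (\<lambda>(\<gamma>, x). thin (\<B> \<gamma>) (coded x))"
  show ?thesis
  proof
    show "fir (t ` \<D>)" unfolding fir_def
    proof safe
      fix F assume F: "finite F" "F \<subseteq> t ` \<D>"
      then obtain A where A: "A \<subseteq> \<D>" "finite A" "F = t ` A" by (meson finite_subset_image)
      show "rich (\<Inter>F)"
      proof (cases "A = {}")
        case True
        then show ?thesis using A(3) rich_UNIV by simp
      next
        case False
        have "rich (\<Inter>(\<gamma>, x)\<in>A. thin (\<B> \<gamma>) (coded x))"
          by (rule rich_thinned[OF A(2) False, of w]) (use A(1) w in \<open>auto simp: \<D>_def\<close>)
        then show ?thesis using A(3) by (simp add: t_def)
      qed
    qed
    show "\<exists>h c. strict_mono h \<and> G = thin h (coded c)" if "G \<in> t ` \<D>" for G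
      using that mono_\<B> unfolding t_def \<D>_def at_level_def by fastforce
    show "\<exists>G\<in>t ` \<D>. G \<subseteq> insert 0 A \<or> G \<subseteq> insert 0 (- A)" for A
    proof -
      obtain x y where xy: "coded x = insert 0 A" "coded y = insert 0 (- A)"
        using coded_surj[of "insert 0 A"] coded_surj[of "insert 0 (- A)"] by auto
      obtain M where M: "M \<in> \<S>" "baire_code E x \<in> M" "baire_code E y \<in> M" using covering by blast
      have "coded x \<union> coded y = UNIV" using xy by blast
      then have "coded x \<in> w (height E M) \<or> coded y \<in> w (height E M)" by (rule w(3))
      then have "(height E M, x) \<in> \<D> \<or> (height E M, y) \<in> \<D>"
        using M unfolding \<D>_def at_level_def by blast
      then show ?thesis
      proof
        assume "(height E M, x) \<in> \<D>"
        moreover have "t (height E M, x) \<subseteq> insert 0 A"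
          using thin_subset[of "\<B> (height E M)" "coded x"] xy(1) by (simp add: t_def)
        ultimately show ?thesis by (intro bexI[of _ "t (height E M, x)"] disjI1 imageI)
      next
        assume "(height E M, y) \<in> \<D>"
        moreover have "t (height E M, y) \<subseteq> insert 0 (- A)"
          using thin_subset[of "\<B> (height E M)" "coded y"] xy(2) by (simp add: t_def)
        ultimately show ?thesis by (intro bexI[of _ "t (height E M, y)"] disjI2 imageI)
      qed
    qed
  qed
qed

end

section \<open>Restricting to suitable models and assembling the ultrafilter\<close>

theorem theorem38:
  fixes \<kappa> :: "'k rel" and E W :: "'h rel"
    and \<B> :: "'h \<Rightarrow> nat \<Rightarrow> nat" and \<S> :: "'h set set"
  assumes "Card_order \<kappa>" and "regularCard \<kappa>" and "|UNIV :: real set| <o \<kappa>"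
    and "is_H \<kappa> E"
    and "well_order_on UNIV W"
    and "multiple_d_pathway E W \<B> \<S>"
  shows "\<exists>U. gruff_ultrafilter U"
proof -
  note \<kappa> = assms(3) and H = assms(4)
  \<comment> \<open>The \<open>Inl\<close> operations supply the codes of thinning relations with
    parameters in the model; the \<open>Inr\<close> operations enumerate the elements of a countable
    member, so that heights are countable ordinals.\<close>
  define F :: "nat + nat \<Rightarrow> 'h list \<Rightarrow> 'h" where
    "F i gs = (case i of Inl n \<Rightarrow> rel_code E (n + 2) (rat.thinning_rel n (map \<B> gs))
       | Inr n \<Rightarrow> from_nat_into (elts E (hd gs)) n)" for i gs
  define \<T> where "\<T> = {M \<in> \<S>. \<forall>i gs. set gs \<subseteq> M \<longrightarrow> F i gs \<in> M}"
  have mono: "\<And>\<alpha>. \<alpha> \<in> omega1 E \<Longrightarrow> strict_mono (\<B> \<alpha>)" and Sub: "\<S> \<subseteq> Sub E W"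
    and stat: "stationary_in UNIV \<S>"
    using assms(6) unfolding multiple_d_pathway_def by blast+
  have path: "tuple_snoc (n + 1) x (\<B> (height E (M n))) \<in> R"
    if "\<And>i. i \<le> n \<Longrightarrow> M i \<in> \<S>" "delta_increasing E n M" "projective (n + 2) R" "adequate (n + 1) R"
      "rel_code E (n + 2) R \<in> M n" "\<And>i. i \<le> n \<Longrightarrow> baire_code E (x i) \<in> M i" for n M R x
    using assms(6) that unfolding multiple_d_pathway_def by blast
  have closed: "y \<in> M" if M: "M \<in> \<T>" and x: "x \<in> M" "countable (elts E x)" "(y, x) \<in> E" for M x y
  proof -
    have "y \<in> elts E x" using x by (simp add: mem_elts)
    then obtain n where "from_nat_into (elts E x) n = y" using from_nat_into_surj x(2) by metis
    then have "F (Inr n) [x] = y" by (simp add: F_def)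
    moreover have "F (Inr n) [x] \<in> M" using M x(1) unfolding \<T>_def by force
    ultimately show ?thesis by simp
  qed
  have height: "elts E (height E M) = M \<inter> omega1 E" "height E M \<in> omega1 E" if M: "M \<in> \<T>" for M
  proof -
    have ct: "countable M" using M Sub by (auto simp: \<T>_def Sub_def)
    show "elts E (height E M) = M \<inter> omega1 E"
      by (rule height_omega1(1)[OF \<kappa> H ct]) (rule closed[OF M])
    show "height E M \<in> omega1 E"
      by (rule height_omega1(2)[OF \<kappa> H ct]) (rule closed[OF M])
  qed
  interpret thinning_pathway rat_code E \<B> \<T>
  proof
    show "rat.rich UNIV" unfolding rat.rich_def using rat_crowd_UNIV by blast
    show "wf E" using H by (simp add: is_H_def)
    show "(height E M, height E N) \<in> E\<^sup>= \<or> (height E N, height E M) \<in> E\<^sup>="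
      if "M \<in> \<T>" "N \<in> \<T>" for M N using omega1_linear[OF \<kappa> H] height that by blast
    show "(\<gamma>, height E M) \<in> E" if "M \<in> \<T>" "(\<gamma>, \<delta>) \<in> E" "(\<delta>, height E M) \<in> E" for M \<gamma> \<delta>
      by (rule omega1_trans[OF height(2)[OF that(1)] that(2,3)])
    show "\<gamma> \<in> M" if "M \<in> \<T>" "(\<gamma>, height E M) \<in> E" for M \<gamma>
      using height(1)[OF that(1)] that(2) by (auto simp: set_eq_iff mem_elts)
    show "strict_mono (\<B> (height E M))" if "M \<in> \<T>" for M using mono height(2)[OF that] .
    show "rel_code E (n + 2) (rat.thinning_rel n (map \<B> gs)) \<in> M" if "M \<in> \<T>" "set gs \<subseteq> M" for M gs n
    proof -
      have "F (Inl n) gs \<in> M" using that unfolding \<T>_def by blast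
      then show ?thesis by (simp add: F_def)
    qed
    show "tuple_snoc (n + 1) x (\<B> (height E (M n))) \<in> R"
      if "\<And>i. i \<le> n \<Longrightarrow> M i \<in> \<T>" "delta_increasing E n M" "projective (n + 2) R" "adequate (n + 1) R"
        "rel_code E (n + 2) R \<in> M n" "\<And>i. i \<le> n \<Longrightarrow> baire_code E (x i) \<in> M i" for n M R x
      by (rule path) (use that in \<open>simp_all add: \<T>_def\<close>)
    show "\<exists>M\<in>\<T>. baire_code E x \<in> M \<and> baire_code E y \<in> M" for x y
    proof -
      \<comment> \<open>Adding two constant operations to \<open>F\<close> yields a model in
        \<open>\<T>\<close> that contains both codes.\<close>
      define F' :: "(nat + nat) + bool \<Rightarrow> 'h list \<Rightarrow> 'h" where
        "F' i gs = (case i of Inl j \<Rightarrow> F j gs | Inr b \<Rightarrow> baire_code E (if b then x else y))" for i gs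
      obtain M where M: "M \<in> \<S>" "\<And>i gs. set gs \<subseteq> M \<Longrightarrow> F' i gs \<in> M"
        using stationary_closed_set[OF stat, of F'] by blast
      have "M \<in> \<T>" using M(1) M(2)[of _ "Inl _"] by (auto simp: \<T>_def F'_def)
      moreover have "baire_code E x \<in> M" using M(2)[of "[]" "Inr True"] by (simp add: F'_def)
      moreover have "baire_code E y \<in> M" using M(2)[of "[]" "Inr False"] by (simp add: F'_def)
      ultimately show ?thesis by blast
    qed
  qed
  show ?thesis by (rule thinned_family) (rule gruff_from_family)
qed

end
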